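(* Let $\bm{X}$ be a real $n\times m$ matrix with $m<n$ (not assumed to have full column rank), and let $\bm{Z}_1,\dots,\bm{Z}_r$ be real matrices, $\bm{Z}_i$ of size $n\times k_i$, with $\sum_{i=1}^r k_i<n$. Consider the variance components model $\bm{Y}=\bm{X}\bm{\beta}+\sum_{i=1}^r\bm{Z}_i\bm{u}_i+\bm{\epsilon}$ and put $\bm{Z}=[\bm{Z}_1,\dots,\bm{Z}_r]$. Let $\bm{y}\in\mathbb{R}^n$ be a realization of $\bm{Y}$. Then the maximum likelihood estimate exists for $\bm{y}$ if and only if $$\bm{y}\notin\mathcal{M}(\bm{X},\bm{Z}),$$ where $\mathcal{M}(\bm{X},\bm{Z})$ is the subspace of $\mathbb{R}^n$ spanned by the columns of $\bm{X}$ and of $\bm{Z}$.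
   Context: In the variance components model, $\bm{\beta}\in\mathbb{R}^m$ is a vector of fixed parameters, $\bm{u}_i\sim\mathcal{N}(\bm{0},\sigma_i^2\bm{I}_{k_i})$ for $i=1,\dots,r$, $\bm{\epsilon}\sim\mathcal{N}(\bm{0},\sigma_0^2\bm{I}_n)$, and all these random vectors are independent. The parameter space is $$\bm{\Theta}=\{(\bm{\beta},\sigma_0^2,\sigma_1^2,\dots,\sigma_r^2)\in\mathbb{R}^m\times(0,\infty)\times[0,\infty)^r\},$$ and one writes $\bm{\sigma}^2=(\sigma_0^2,\sigma_1^2,\dots,\sigma_r^2)$. The covariance matrix of $\bm{Y}$ is $\bm{V}(\bm{\sigma}^2)=\sigma_0^2\bm{I}_n+\sum_{i=1}^r\sigma_i^2\bm{Z}_i\bm{Z}_i'$, where $'$ denotes transpose. Up to an additive constant, minus twice the log-likelihood is $$l(\bm{\beta},\bm{\sigma}^2,\bm{y})=\log|\bm{V}(\bm{\sigma}^2)|+(\bm{y}-\bm{X}\bm{\beta})'\bm{V}^{-1}(\bm{\sigma}^2)(\bm{y}-\bm{X}\bm{\beta}),$$ where $|\cdot|$ is the determinant. The maximum likelihood estimate is said to exist for $\bm{y}$ if and only if the set of minimizers of $(\bm{\beta},\bm{\sigma}^2)\mapsto l(\bm{\beta},\bm{\sigma}^2,\bm{y})$ over $\bm{\Theta}$ is nonempty, i.e. $l(\cdot,\bm{y})$ attains a minimum on $\bm{\Theta}$. *)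

theory Defs
  imports
    "Jordan_Normal_Form.VS_Connect"
    "Jordan_Normal_Form.Gauss_Jordan_Elimination"
begin

text \<open>
  The variance components model \<open>Y = X \<beta> + Z\<^sub>1 u\<^sub>1 + \<dots> + Z\<^sub>r u\<^sub>r + \<epsilon>\<close> with independent
  \<open>u\<^sub>i \<sim> N(0, \<sigma>\<^sub>i\<^sup>2 I)\<close> and \<open>\<epsilon> \<sim> N(0, \<sigma>\<^sub>0\<^sup>2 I\<^sub>n)\<close>, so that \<open>Y \<sim> N(X \<beta>, V(\<sigma>\<^sup>2))\<close>.
  The design matrices are \<open>Z i\<close> for \<open>i = 1, \<dots>, r\<close>; \<open>Z\<close> at other indices is irrelevant.
  The variance components form a vector \<open>s\<close> of dimension \<open>r + 1\<close> whose entry \<open>s $ i\<close> is the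
  variance \<open>\<sigma>\<^sub>i\<^sup>2\<close> itself, not its square root.
\<close>

definition param_space :: "nat \<Rightarrow> nat \<Rightarrow> (real vec \<times> real vec) set" where
  "param_space m r =
     {(b, s). b \<in> carrier_vec m \<and> s \<in> carrier_vec (r + 1) \<and>
              s $ 0 > 0 \<and> (\<forall>i\<in>{1..r}. s $ i \<ge> 0)}"

definition cov_mat :: "nat \<Rightarrow> nat \<Rightarrow> (nat \<Rightarrow> real mat) \<Rightarrow> real vec \<Rightarrow> real mat" where
  "cov_mat n r Z s =
     s $ 0 \<cdot>\<^sub>m 1\<^sub>m n +
     finsum (module_mat TYPE(real) n n) (\<lambda>i. s $ i \<cdot>\<^sub>m (Z i * transpose_mat (Z i))) {1..r}"

text \<open>
  Minus twice the log-likelihood, up to an additive constant. On the parameter space \<open>V\<close> is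
  positive definite (because \<open>\<sigma>\<^sub>0\<^sup>2 > 0\<close>), so \<open>mat_inverse V\<close> is not \<open>None\<close> and \<open>det V > 0\<close>.
\<close>

definition neg2_loglik ::
  "nat \<Rightarrow> nat \<Rightarrow> real mat \<Rightarrow> (nat \<Rightarrow> real mat) \<Rightarrow> real vec \<Rightarrow> real vec \<Rightarrow> real vec \<Rightarrow> real" where
  "neg2_loglik n r X Z b s y =
     (let V = cov_mat n r Z s; e = y - X *\<^sub>v b
      in ln (det V) + e \<bullet> (the (mat_inverse V) *\<^sub>v e))"

definition mle_set ::
  "nat \<Rightarrow> nat \<Rightarrow> nat \<Rightarrow> real mat \<Rightarrow> (nat \<Rightarrow> real mat) \<Rightarrow> real vec \<Rightarrow> (real vec \<times> real vec) set" where
  "mle_set n m r X Z y =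
     {(b, s) \<in> param_space m r. \<forall>(b', s') \<in> param_space m r.
        neg2_loglik n r X Z b s y \<le> neg2_loglik n r X Z b' s' y}"

definition mle_exists ::
  "nat \<Rightarrow> nat \<Rightarrow> nat \<Rightarrow> real mat \<Rightarrow> (nat \<Rightarrow> real mat) \<Rightarrow> real vec \<Rightarrow> bool" where
  "mle_exists n m r X Z y \<longleftrightarrow> mle_set n m r X Z y \<noteq> {}"

text \<open>The block matrix \<open>[Z\<^sub>1, \<dots>, Z\<^sub>r]\<close>.\<close>

definition block_row :: "nat \<Rightarrow> nat \<Rightarrow> (nat \<Rightarrow> real mat) \<Rightarrow> real mat" where
  "block_row n r Z = mat_of_cols n (concat (map (\<lambda>i. cols (Z i)) [1..<r + 1]))"

definition joint_col_space :: "nat \<Rightarrow> real mat \<Rightarrow> real mat \<Rightarrow> real vec set" where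
  "joint_col_space n A B =
     LinearCombinations.module.span class_ring (module_vec TYPE(real) n)
       (set (cols A) \<union> set (cols B))"

end

theory Submission
  imports Defs "HOL-Analysis.Function_Topology"
begin

text \<open>
  Two facts drive the proof. First, duality:
  \<open>e' V\<^sup>-\<^sup>1 e = max\<^sub>v (2 v' e - v' V v)\<close>, attained at \<open>v = V\<^sup>-\<^sup>1 e\<close>. Second, adding
  rank-one terms \<open>t z z'\<close> with \<open>t \<ge> 0\<close> to a positive definite matrix does not decrease its determinant.

  If \<open>y = X \<beta> + Z w\<close>, let \<open>\<sigma>\<^sub>0\<^sup>2 = \<epsilon>\<close> and all other variances be 1. As \<open>\<epsilon>\<close> tends to 0, the quadratic
  form stays bounded, while \<open>det V\<close> tends to \<open>det (Z Z') = 0\<close> because \<open>Z\<close> has fewer than \<open>n\<close> columns,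
  so the objective is unbounded below.

  Otherwise let \<open>u \<noteq> 0\<close> be the residual of projecting \<open>y\<close> orthogonally to the columns of \<open>X\<close> and \<open>Z\<close>.
  Duality with \<open>v = u / \<sigma>\<^sub>0\<^sup>2\<close> and the determinant bound give, for every column \<open>z\<close> of \<open>Z\<^sub>i\<close>,
  \<open>l \<ge> n log \<sigma>\<^sub>0\<^sup>2 + log (1 + \<sigma>\<^sub>i\<^sup>2 |z|\<^sup>2 / \<sigma>\<^sub>0\<^sup>2) + |u|\<^sup>2 / \<sigma>\<^sub>0\<^sup>2\<close>,
  which confines the relevant variances to a compact box. Minimising over \<open>\<beta>\<close> first (generalised least
  squares) leaves the profile \<open>log det V + max {2 v' y - v' V v | v \<bottom> X}\<close>, a maximum of
  continuous functions of the variances, hence lower semicontinuous, so it attains its minimum on the box.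
  Since no compactness in \<open>\<beta>\<close> is needed, the rank of \<open>X\<close> plays no role.
\<close>

section \<open>Spans and orthogonal projection\<close>

abbreviation vspan :: "nat \<Rightarrow> real vec set \<Rightarrow> real vec set" where
  "vspan n \<equiv> LinearCombinations.module.span class_ring (module_vec TYPE(real) n)"

text \<open>The carrier vectors satisfying \<open>P\<close> form a submodule containing
  \<open>S\<close>, and the span is the least such submodule.\<close>

lemma vspan_induct [consumes 2, case_names zero base add smult]:
  assumes "x \<in> vspan n S" and S: "S \<subseteq> carrier_vec n"
    and zero: "P (0\<^sub>v n)"
    and base: "\<And>x. x \<in> S \<Longrightarrow> P x"
    and add: "\<And>x y. x \<in> carrier_vec n \<Longrightarrow> y \<in> carrier_vec n \<Longrightarrow> P x \<Longrightarrow> P y \<Longrightarrow> P (x + y)"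
    and smult: "\<And>c x. x \<in> carrier_vec n \<Longrightarrow> P x \<Longrightarrow> P (c \<cdot>\<^sub>v x)"
  shows "P x"
proof -
  interpret vec_space "TYPE(real)" n .
  have "submodule class_ring {v \<in> carrier_vec n. P v} V"
    unfolding LinearCombinations.submodule_def
    using zero add smult module_axioms by (auto simp: module_vec_simps)
  from span_is_subset[OF _ this, of S] have "span S \<subseteq> {v \<in> carrier_vec n. P v}"
    using S base by auto
  then show ?thesis using assms(1) by auto
qed

lemma
  assumes "S \<subseteq> carrier_vec n"
  shows vspan_carrier: "x \<in> vspan n S \<Longrightarrow> x \<in> carrier_vec n"
    and vspan_zero: "0\<^sub>v n \<in> vspan n S"
    and vspan_base: "x \<in> S \<Longrightarrow> x \<in> vspan n S"
    and vspan_add: "x \<in> vspan n S \<Longrightarrow> y \<in> vspan n S \<Longrightarrow> x + y \<in> vspan n S"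
    and vspan_smult: "x \<in> vspan n S \<Longrightarrow> c \<cdot>\<^sub>v x \<in> vspan n S"
proof -
  interpret vec_space "TYPE(real)" n .
  have S: "submodule class_ring (span S) V" using assms span_is_submodule by simp
  show "x \<in> vspan n S \<Longrightarrow> x \<in> carrier_vec n" using span_closed[OF assms] by simp
  show "0\<^sub>v n \<in> vspan n S" using submodule.zero_closed[OF S] by (simp add: module_vec_simps)
  show "x \<in> S \<Longrightarrow> x \<in> vspan n S" using in_own_span assms by auto
  show "x \<in> vspan n S \<Longrightarrow> y \<in> vspan n S \<Longrightarrow> x + y \<in> vspan n S"
    using submodule.m_closed[OF S] by (simp add: module_vec_simps)
  show "x \<in> vspan n S \<Longrightarrow> c \<cdot>\<^sub>v x \<in> vspan n S"
    using submodule.smult_closed[OF S] by (simp add: module_vec_simps)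
qed

lemma vspan_minus:
  assumes "S \<subseteq> carrier_vec n" "x \<in> vspan n S" "y \<in> vspan n S"
  shows "x - y \<in> vspan n S"
proof -
  have "x - y = x + (-1) \<cdot>\<^sub>v y"
    using vspan_carrier[OF assms(1)] assms(2,3) by (intro eq_vecI) auto
  then show ?thesis using assms vspan_add vspan_smult by metis
qed

lemma vspan_orthogonal:
  fixes A :: "real mat"
  assumes "A \<in> carrier_mat n n" "S \<subseteq> carrier_vec n" "e \<in> carrier_vec n"
    and "\<forall>x\<in>S. x \<bullet> (A *\<^sub>v e) = 0" and "x \<in> vspan n S"
  shows "x \<bullet> (A *\<^sub>v e) = 0"
  using assms(5,2)
proof (induction rule: vspan_induct)
  case zero
  then show ?case using assms by auto
next
  case (base x)
  then show ?case using assms by auto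
next
  case (add x y)
  then show ?case using assms add_scalar_prod_distrib[of x n y "A *\<^sub>v e"] by auto
next
  case (smult c x)
  then show ?case using assms by auto
qed

text \<open>Gram-Schmidt for the bilinear form of \<open>A\<close>, one vector of \<open>S\<close>
  at a time: the induction hypothesis projects both \<open>y\<close> and the new vector
  \<open>x\<close>. It serves below with \<open>A\<close> the identity and with
  \<open>A = V^-1\<close>.\<close>

lemma orthogonal_projection:
  fixes A :: "real mat"
  assumes A: "A \<in> carrier_mat n n"
    and sym: "\<And>u v. u \<in> carrier_vec n \<Longrightarrow> v \<in> carrier_vec n \<Longrightarrow> u \<bullet> (A *\<^sub>v v) = v \<bullet> (A *\<^sub>v u)"
    and pd: "\<And>v. v \<in> carrier_vec n \<Longrightarrow> v \<bullet> (A *\<^sub>v v) = 0 \<Longrightarrow> v = 0\<^sub>v n"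
    and "finite S" "S \<subseteq> carrier_vec n" "y \<in> carrier_vec n"
  shows "\<exists>u\<in>vspan n S. \<forall>x\<in>S. x \<bullet> (A *\<^sub>v (y - u)) = 0"
  using assms(4-)
proof (induction S arbitrary: y rule: finite_induct)
  case empty
  then show ?case using vspan_zero[of "{}" n] by auto
next
  case (insert x S)
  let ?T = "insert x S"
  have S: "S \<subseteq> carrier_vec n" and T: "?T \<subseteq> carrier_vec n" and x: "x \<in> carrier_vec n"
    using insert by auto
  have mono: "v \<in> vspan n ?T" if "v \<in> vspan n S" for v
    using that S by (induction rule: vspan_induct) (use vspan_zero[OF T] vspan_base[OF T] vspan_add[OF T] vspan_smult[OF T] in auto)
  obtain u where u: "u \<in> vspan n S" "\<forall>s\<in>S. s \<bullet> (A *\<^sub>v (y - u)) = 0"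
    using insert.IH[OF S insert.prems(2)] by blast
  obtain w where w: "w \<in> vspan n S" "\<forall>s\<in>S. s \<bullet> (A *\<^sub>v (x - w)) = 0"
    using insert.IH[OF S] x by blast
  have uc: "u \<in> carrier_vec n" and wc: "w \<in> carrier_vec n" using u w vspan_carrier[OF S] by auto
  define e f where "e = y - u" and "f = x - w"
  have ec: "e \<in> carrier_vec n" and fc: "f \<in> carrier_vec n" using uc wc x insert.prems by (auto simp: e_def f_def)
  \<comment> \<open>The coefficient that makes \<open>y - (u + b f)\<close> orthogonal to
    \<open>x\<close>; a zero denominator gives \<open>b = 0\<close>.\<close>
  define b where "b = (x \<bullet> (A *\<^sub>v e)) / (x \<bullet> (A *\<^sub>v f))"
  have perp: "s \<bullet> (A *\<^sub>v e) = 0" "s \<bullet> (A *\<^sub>v f) = 0" if "s \<in> vspan n S" for s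
    using vspan_orthogonal[OF A S _ _ that] u(2) w(2) ec fc by (auto simp: e_def f_def)
  have fx: "f \<bullet> (A *\<^sub>v v) = x \<bullet> (A *\<^sub>v v) - w \<bullet> (A *\<^sub>v v)" if "v \<in> carrier_vec n" for v
    unfolding f_def using x wc A that by (intro minus_scalar_prod_distrib[of _ n]) auto
  have key: "x \<bullet> (A *\<^sub>v e) - b * (x \<bullet> (A *\<^sub>v f)) = 0"
  proof (cases "x \<bullet> (A *\<^sub>v f) = 0")
    \<comment> \<open>A zero denominator forces \<open>f = 0\<close> by definiteness, so
      \<open>x = w\<close> already lies in the span of \<open>S\<close>, to which \<open>e\<close>
      is orthogonal.\<close>
    case True
    then have "f \<bullet> (A *\<^sub>v f) = 0" using fx[OF fc] perp(2)[OF w(1)] by simp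
    then have "f = 0\<^sub>v n" using pd fc by auto
    then have "f \<bullet> (A *\<^sub>v e) = 0" using A ec by auto
    then have "x \<bullet> (A *\<^sub>v e) = 0" using fx[OF ec] perp(1)[OF w(1)] by simp
    then show ?thesis using True by simp
  qed (auto simp: b_def)
  let ?u = "u + b \<cdot>\<^sub>v f"
  have "?u \<in> vspan n ?T"
    unfolding f_def by (intro vspan_add[OF T] vspan_smult[OF T] vspan_minus[OF T] mono u w vspan_base[OF T]) auto
  moreover have "s \<bullet> (A *\<^sub>v (y - ?u)) = 0" if "s \<in> ?T" for s
  proof -
    have s: "s \<in> carrier_vec n" using that T by auto
    have "y - ?u = e - b \<cdot>\<^sub>v f" using insert.prems uc fc by (intro eq_vecI) (auto simp: e_def)
    then have "A *\<^sub>v (y - ?u) = A *\<^sub>v e - b \<cdot>\<^sub>v (A *\<^sub>v f)"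
      using A ec fc by (simp add: mult_minus_distrib_mat_vec[of _ n n] mult_mat_vec[of _ n n])
    then have "s \<bullet> (A *\<^sub>v (y - ?u)) = s \<bullet> (A *\<^sub>v e) - b * (s \<bullet> (A *\<^sub>v f))"
      using A ec fc s by (simp add: scalar_prod_minus_distrib[of _ n])
    then show ?thesis using that key perp vspan_base[OF S] by auto
  qed
  ultimately show ?case by blast
qed

section \<open>Determinants and inverses of Gram-type matrices\<close>

text \<open>The matrix determinant lemma, with \<open>w\<close> in the role of
  \<open>A^-1 x\<close>: \<open>A + x z' = A (1 + w z')\<close> and
  \<open>det (1 + w z') = 1 + z' w\<close>.\<close>

lemma det_add_outer_product:
  fixes A :: "'a :: field mat"
  assumes A: "A \<in> carrier_mat n n" and w: "w \<in> carrier_vec n" and x: "x \<in> carrier_vec n"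
    and z: "z \<in> carrier_vec n" and Aw: "A *\<^sub>v w = x"
  shows "det (A + mat n n (\<lambda>(i, j). x $ i * z $ j)) = det A * (1 + z \<bullet> w)"
proof -
  define W Zt where "W = mat n 1 (\<lambda>(i, j). w $ i)" and "Zt = mat 1 n (\<lambda>(i, j). z $ j)"
  define D where "D = mat n n (\<lambda>(i, j). w $ i * z $ j)"
  have c: "W \<in> carrier_mat n 1" "Zt \<in> carrier_mat 1 n" "D \<in> carrier_mat n n"
    by (auto simp: W_def Zt_def D_def)
  have WZ: "W * Zt = D"
    by (intro eq_matI) (auto simp: W_def Zt_def D_def scalar_prod_def)
  have ZW: "1\<^sub>m 1 + Zt * W = mat 1 1 (\<lambda>_. 1 + z \<bullet> w)"
    using w z by (intro eq_matI) (auto simp: W_def Zt_def scalar_prod_def)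
  have "A + mat n n (\<lambda>(i, j). x $ i * z $ j) = A * (1\<^sub>m n + D)"
  proof -
    have "A * D = mat n n (\<lambda>(i, j). x $ i * z $ j)"
    proof (intro eq_matI)
      fix i j assume ij: "i < dim_row (mat n n (\<lambda>(i, j). x $ i * z $ j))" "j < dim_col (mat n n (\<lambda>(i, j). x $ i * z $ j))"
      have "(A * D) $$ (i, j) = (\<Sum>k = 0..<n. A $$ (i, k) * w $ k) * z $ j"
        using A ij by (auto simp: D_def scalar_prod_def sum_distrib_right mult.assoc)
      also have "(\<Sum>k = 0..<n. A $$ (i, k) * w $ k) = (A *\<^sub>v w) $ i"
        using A w ij by (auto simp: scalar_prod_def)
      finally show "(A * D) $$ (i, j) = mat n n (\<lambda>(i, j). x $ i * z $ j) $$ (i, j)"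
        using Aw ij by auto
    qed (use A c in auto)
    then show ?thesis using A c mult_add_distrib_mat[of A n n "1\<^sub>m n" n D] by simp
  qed
  moreover have "det (1\<^sub>m n + D) = 1 + z \<bullet> w"
  proof -
    \<comment> \<open>Block elimination: unit lower triangular factors on both sides turn
      \<open>?M\<close> into \<open>?T\<close> without changing the determinant. Both are block
      upper triangular, so their determinants can be read off the diagonal blocks.\<close>
    let ?L = "\<lambda>Y. four_block_mat (1\<^sub>m n) (0\<^sub>m n 1) Y (1\<^sub>m 1)"
    let ?M = "four_block_mat (1\<^sub>m n + D) W (0\<^sub>m 1 n) (1\<^sub>m 1)"
    let ?T = "four_block_mat (1\<^sub>m n) W (0\<^sub>m 1 n) (1\<^sub>m 1 + Zt * W)"
    let ?P = "four_block_mat (1\<^sub>m n) W (- Zt) (1\<^sub>m 1)"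
    have "?M * ?L (- Zt) = ?P"
      using c by (subst mult_four_block_mat[of _ n n _ 1 _ 1 _ _ n _ 1])
        (auto simp: WZ uminus_mult_right_mat[symmetric] intro!: cong_four_block_mat eq_matI)
    moreover have "?L Zt * ?P = ?T"
      using c by (subst mult_four_block_mat[of _ n n _ 1 _ 1 _ _ n _ 1])
        (auto intro!: cong_four_block_mat eq_matI)
    ultimately have eq: "?L Zt * (?M * ?L (- Zt)) = ?T" by simp
    have L: "?L Y \<in> carrier_mat (n + 1) (n + 1)" "det (?L Y) = 1" if "Y \<in> carrier_mat 1 n" for Y :: "'a mat"
      using that det_four_block_mat_upper_right_zero[of "1\<^sub>m n" n "0\<^sub>m n 1" 1 Y "1\<^sub>m 1"]
      by (auto intro!: four_block_carrier_mat)
    have M: "?M \<in> carrier_mat (n + 1) (n + 1)"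
      using c by (intro four_block_carrier_mat) auto
    have "- Zt \<in> carrier_mat 1 n" using c by simp
    note L' = L[OF c(2)] L[OF this]
    have "det ?M = det ?T"
      unfolding eq[symmetric]
      using det_mult[OF L'(1) mult_carrier_mat[OF M L'(3)]] det_mult[OF M L'(3)] L'(2,4) by simp
    moreover have "det ?M = det (1\<^sub>m n + D)"
      using c det_four_block_mat_lower_left_zero[of "1\<^sub>m n + D" n W 1 "0\<^sub>m 1 n" "1\<^sub>m 1"] by simp
    moreover have "det ?T = det (1\<^sub>m n :: 'a mat) * det (1\<^sub>m 1 + Zt * W)"
      using c by (intro det_four_block_mat_lower_left_zero) auto
    then have "det ?T = 1 + z \<bullet> w"
      unfolding ZW by (simp add: det_single)
    ultimately show ?thesis by simp
  qed
  ultimately show ?thesis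
    using det_mult[OF A, of "1\<^sub>m n + D"] c by simp
qed

text \<open>The matrix \<open>c I + \<Sum> t p z p (z p)'\<close>. One rank-one term per column,
  instead of one block per design matrix, lets determinants be built up column by column.\<close>

definition gram_mat :: "nat \<Rightarrow> real \<Rightarrow> ('p \<Rightarrow> real) \<Rightarrow> ('p \<Rightarrow> real vec) \<Rightarrow> 'p set \<Rightarrow> real mat" where
  "gram_mat n c t z J =
     mat n n (\<lambda>(a, b). (if a = b then c else 0) + (\<Sum>p\<in>J. t p * (z p $ a * z p $ b)))"

section \<open>Positive definiteness, inversion and duality for Gram matrices\<close>

lemma gram_mat_carrier [simp]: "gram_mat n c t z J \<in> carrier_mat n n"
  "dim_row (gram_mat n c t z J) = n" "dim_col (gram_mat n c t z J) = n"
  by (auto simp: gram_mat_def)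

lemma gram_mat_bilinear:
  assumes "\<And>p. p \<in> J \<Longrightarrow> z p \<in> carrier_vec n" "u \<in> carrier_vec n" "v \<in> carrier_vec n"
  shows "u \<bullet> (gram_mat n c t z J *\<^sub>v v) = c * (u \<bullet> v) + (\<Sum>p\<in>J. t p * ((z p \<bullet> u) * (z p \<bullet> v)))"
proof -
  have "u \<bullet> (gram_mat n c t z J *\<^sub>v v) = (\<Sum>a<n. \<Sum>b<n. u $ a * (((if a = b then c else 0) + (\<Sum>p\<in>J. t p * (z p $ a * z p $ b))) * v $ b))"
    using assms by (auto simp: scalar_prod_def gram_mat_def sum_distrib_left atLeast0LessThan intro!: sum.cong)
  also have "\<dots> = (\<Sum>a<n. \<Sum>b<n. (if a = b then c * (u $ a * v $ b) else 0)) + (\<Sum>a<n. \<Sum>b<n. \<Sum>p\<in>J. t p * ((z p $ a * u $ a) * (z p $ b * v $ b)))"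
    unfolding sum.distrib[symmetric]
    by (intro sum.cong refl) (auto simp: algebra_simps sum_distrib_left sum_distrib_right)
  also have "(\<Sum>a<n. \<Sum>b<n. (if a = b then c * (u $ a * v $ b) else 0)) = c * (u \<bullet> v)"
    using assms by (auto simp: scalar_prod_def sum_distrib_left atLeast0LessThan intro!: sum.cong)
  also have "(\<Sum>a<n. \<Sum>b<n. \<Sum>p\<in>J. t p * ((z p $ a * u $ a) * (z p $ b * v $ b)))
    = (\<Sum>p\<in>J. \<Sum>a<n. \<Sum>b<n. t p * ((z p $ a * u $ a) * (z p $ b * v $ b)))"
    by (subst (2) sum.swap, subst sum.swap) simp
  also have "\<dots> = (\<Sum>p\<in>J. t p * ((z p \<bullet> u) * (z p \<bullet> v)))"
  proof (intro sum.cong refl)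
    fix p assume "p \<in> J"
    have "z p \<bullet> u = (\<Sum>a<n. z p $ a * u $ a)" "z p \<bullet> v = (\<Sum>a<n. z p $ a * v $ a)"
      using assms by (auto simp: scalar_prod_def atLeast0LessThan)
    then show "(\<Sum>a<n. \<Sum>b<n. t p * ((z p $ a * u $ a) * (z p $ b * v $ b))) = t p * ((z p \<bullet> u) * (z p \<bullet> v))"
      by (simp only: sum_product) (simp only: sum_distrib_left)
  qed
  finally show ?thesis .
qed

lemma gram_mat_quadratic_ge:
  assumes "\<And>p. p \<in> J \<Longrightarrow> z p \<in> carrier_vec n" "\<And>p. p \<in> J \<Longrightarrow> t p \<ge> 0" "v \<in> carrier_vec n"
  shows "v \<bullet> (gram_mat n c t z J *\<^sub>v v) \<ge> c * (v \<bullet> v)"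
  using assms by (auto simp: gram_mat_bilinear intro!: sum_nonneg)

lemma scalar_prod_self_real:
  fixes v :: "real vec"
  assumes "v \<in> carrier_vec n"
  shows "v \<bullet> v \<ge> 0" "v \<bullet> v = 0 \<longleftrightarrow> v = 0\<^sub>v n"
  using assms by (auto simp: scalar_prod_def sum_nonneg_eq_0_iff intro!: sum_nonneg eq_vecI)

lemma gram_mat_pos_def:
  assumes "\<And>p. p \<in> J \<Longrightarrow> z p \<in> carrier_vec n" "\<And>p. p \<in> J \<Longrightarrow> t p \<ge> 0" "v \<in> carrier_vec n" "c > 0"
  shows "v \<bullet> (gram_mat n c t z J *\<^sub>v v) \<ge> 0"
    and "v \<bullet> (gram_mat n c t z J *\<^sub>v v) = 0 \<Longrightarrow> v = 0\<^sub>v n"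
proof -
  note ge = gram_mat_quadratic_ge[of J z n t v c, OF assms(1-3)]
  have "c * (v \<bullet> v) \<ge> 0" using assms scalar_prod_self_real by auto
  with ge show "v \<bullet> (gram_mat n c t z J *\<^sub>v v) \<ge> 0" by linarith
  assume "v \<bullet> (gram_mat n c t z J *\<^sub>v v) = 0"
  with ge \<open>c * (v \<bullet> v) \<ge> 0\<close> have "c * (v \<bullet> v) = 0" by linarith
  then show "v = 0\<^sub>v n" using assms scalar_prod_self_real(2) by auto
qed

text \<open>A nonzero kernel vector would contradict positive definiteness, so the determinant is
  nonzero and \<open>mat_inverse\<close> succeeds.\<close>

lemma gram_mat_inverse:
  assumes "\<And>p. p \<in> J \<Longrightarrow> z p \<in> carrier_vec n" "\<And>p. p \<in> J \<Longrightarrow> t p \<ge> 0" "c > 0"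
  shows "the (mat_inverse (gram_mat n c t z J)) \<in> carrier_mat n n"
    and "e \<in> carrier_vec n \<Longrightarrow> gram_mat n c t z J *\<^sub>v (the (mat_inverse (gram_mat n c t z J)) *\<^sub>v e) = e"
proof -
  let ?G = "gram_mat n c t z J"
  have "det ?G \<noteq> 0"
  proof
    assume "det ?G = 0"
    then obtain v where v: "v \<in> carrier_vec n" "v \<noteq> 0\<^sub>v n" "?G *\<^sub>v v = 0\<^sub>v n"
      using det_0_iff_vec_prod_zero[of ?G n] by auto
    then have "v \<bullet> (?G *\<^sub>v v) = 0" by simp
    then show False using gram_mat_pos_def(2)[of J z n t v c] assms v by auto
  qed
  then have "?G \<in> Units (ring_mat TYPE(real) n ())"
    by (intro det_non_zero_imp_unit) auto
  then have "mat_inverse ?G \<noteq> None"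
    using mat_inverse(1)[of ?G n "()"] by (metis gram_mat_carrier(1))
  then obtain B where B: "mat_inverse ?G = Some B" by auto
  note inv = mat_inverse(2)[OF gram_mat_carrier(1) B]
  then show "the (mat_inverse ?G) \<in> carrier_mat n n" using B by auto
  show "e \<in> carrier_vec n \<Longrightarrow> ?G *\<^sub>v (the (mat_inverse ?G) *\<^sub>v e) = e"
    using B inv assoc_mult_mat_vec[of ?G n n B n e] by auto
qed

text \<open>Completing the square: expand \<open>(v - w)' G (v - w) \<ge> 0\<close> using
  \<open>G w = e\<close>. This trades the inverse for expressions that are affine in the
  variances.\<close>

lemma gram_mat_dual:
  assumes "\<And>p. p \<in> J \<Longrightarrow> z p \<in> carrier_vec n" "\<And>p. p \<in> J \<Longrightarrow> t p \<ge> 0" "c > 0"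
    and e: "e \<in> carrier_vec n"
  defines "w \<equiv> the (mat_inverse (gram_mat n c t z J)) *\<^sub>v e"
  shows "v \<in> carrier_vec n \<Longrightarrow> 2 * (v \<bullet> e) - v \<bullet> (gram_mat n c t z J *\<^sub>v v) \<le> e \<bullet> w"
    and "2 * (w \<bullet> e) - w \<bullet> (gram_mat n c t z J *\<^sub>v w) = e \<bullet> w"
    and "w \<in> carrier_vec n"
proof -
  let ?G = "gram_mat n c t z J"
  have inv: "the (mat_inverse ?G) \<in> carrier_mat n n" "?G *\<^sub>v (the (mat_inverse ?G) *\<^sub>v e) = e"
    using gram_mat_inverse[of J z n t c] assms(1-3) e by auto
  show w: "w \<in> carrier_vec n" using inv(1) e by (auto simp: w_def)
  have Gw: "?G *\<^sub>v w = e" using inv(2) by (simp add: w_def)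
  have ew: "e \<bullet> w = w \<bullet> e" using e w comm_scalar_prod by auto
  show "2 * (w \<bullet> e) - w \<bullet> (?G *\<^sub>v w) = e \<bullet> w" using Gw ew by simp
  assume v: "v \<in> carrier_vec n"
  have "w \<bullet> (?G *\<^sub>v v) = v \<bullet> (?G *\<^sub>v w)"
    using assms(1) v w comm_scalar_prod[OF v w] by (simp add: gram_mat_bilinear mult_ac)
  then have "w \<bullet> (?G *\<^sub>v v) = v \<bullet> e" using Gw by simp
  have "0 \<le> (v - w) \<bullet> (?G *\<^sub>v (v - w))"
    using assms v w by (intro gram_mat_pos_def(1)) auto
  also have "\<dots> = v \<bullet> (?G *\<^sub>v v) - v \<bullet> e - (w \<bullet> (?G *\<^sub>v v) - w \<bullet> e)"
    using v w e Gw mult_mat_vec_carrier[OF gram_mat_carrier(1) v, of c t z J]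
      minus_scalar_prod_distrib[of v n w "?G *\<^sub>v v - e"]
    by (simp add: mult_minus_distrib_mat_vec[of _ n n] scalar_prod_minus_distrib[of _ n])
  finally show "2 * (v \<bullet> e) - v \<bullet> (?G *\<^sub>v v) \<le> e \<bullet> w"
    using \<open>w \<bullet> (?G *\<^sub>v v) = v \<bullet> e\<close> ew by simp
qed

section \<open>Growth of the determinant as columns are added\<close>

lemma gram_mat_insert:
  assumes "finite J" "p \<notin> J" "z p \<in> carrier_vec n"
  shows "gram_mat n c t z (insert p J) =
    gram_mat n c t z J + mat n n (\<lambda>(a, b). (t p \<cdot>\<^sub>v z p) $ a * z p $ b)"
  using assms by (intro eq_matI) (auto simp: gram_mat_def)

lemma det_gram_mat_empty: "det (gram_mat n c t z {}) = c ^ n"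
proof -
  have "gram_mat n c t z {} = c \<cdot>\<^sub>m 1\<^sub>m n" by (intro eq_matI) (auto simp: gram_mat_def)
  then show ?thesis by simp
qed

lemma det_gram_mat_insert:
  assumes "finite J" "p \<notin> J" "\<And>q. q \<in> insert p J \<Longrightarrow> z q \<in> carrier_vec n"
    and "w \<in> carrier_vec n" "gram_mat n c t z J *\<^sub>v w = z p"
  shows "det (gram_mat n c t z (insert p J)) = det (gram_mat n c t z J) * (1 + t p * (z p \<bullet> w))"
proof -
  have "gram_mat n c t z J *\<^sub>v (t p \<cdot>\<^sub>v w) = t p \<cdot>\<^sub>v z p"
    using assms by (simp add: mult_mat_vec[of _ n n])
  from det_add_outer_product[OF _ _ _ _ this, of n "z p"] show ?thesis
    using assms by (simp add: gram_mat_insert)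
qed

text \<open>Columns of \<open>J - I\<close> are added one at a time, each multiplying the
  determinant by some \<open>1 + t z' G^-1 z \<ge> 1\<close>. Positivity is assumed at
  \<open>I\<close> alone, so the case \<open>I = {}\<close> yields positivity in general.\<close>

lemma det_gram_mat_mono:
  assumes "finite J" "I \<subseteq> J" "c > 0" "\<And>p. p \<in> J \<Longrightarrow> z p \<in> carrier_vec n" "\<And>p. p \<in> J \<Longrightarrow> t p \<ge> 0"
    and pos: "det (gram_mat n c t z I) > 0"
  shows "det (gram_mat n c t z I) \<le> det (gram_mat n c t z J)"
proof -
  have "D \<subseteq> J - I \<Longrightarrow> det (gram_mat n c t z I) \<le> det (gram_mat n c t z (D \<union> I))" if "finite D" for D
    using that
  proof (induction D rule: finite_induct)
    case (insert p D)
    let ?G = "gram_mat n c t z (D \<union> I)"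
    define w where "w = the (mat_inverse ?G) *\<^sub>v z p"
    have fin: "finite (D \<union> I)" using insert assms finite_subset by auto
    have sub: "insert p (D \<union> I) \<subseteq> J" "p \<notin> D \<union> I" using insert assms by auto
    then have zt: "\<And>q. q \<in> D \<union> I \<Longrightarrow> z q \<in> carrier_vec n" "\<And>q. q \<in> D \<union> I \<Longrightarrow> t q \<ge> 0"
      "z p \<in> carrier_vec n" "t p \<ge> 0" using assms by auto
    have w: "w \<in> carrier_vec n" "?G *\<^sub>v w = z p"
      unfolding w_def using gram_mat_inverse[of "D \<union> I" z n t c] zt assms(3)
      by (auto intro!: mult_mat_vec_carrier)
    \<comment> \<open>This number is \<open>z' G^-1 z\<close>; written as \<open>w' G w\<close> it
      is visibly nonnegative.\<close>
    have "z p \<bullet> w = w \<bullet> (?G *\<^sub>v w)" using w zt comm_scalar_prod by auto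
    then have "z p \<bullet> w \<ge> 0" using gram_mat_pos_def(1)[of "D \<union> I" z n t w c] zt w(1) assms(3) by simp
    then have "1 \<le> 1 + t p * (z p \<bullet> w)" using zt by simp
    moreover have IH: "det (gram_mat n c t z I) \<le> det ?G" using insert by auto
    ultimately have "det ?G \<le> det ?G * (1 + t p * (z p \<bullet> w))"
      using pos by (intro mult_right_le_one_le[THEN order_trans] | simp add: mult_le_cancel_left1)+
    also have "\<dots> = det (gram_mat n c t z (insert p (D \<union> I)))"
      using fin sub(2) zt w by (subst det_gram_mat_insert[where w = w]) auto
    finally show ?case using IH by simp
  qed simp
  from this[of "J - I"] show ?thesis using assms by (simp add: Un_absorb2)
qed

lemma det_gram_mat_pos:
  assumes "finite J" "c > 0" "\<And>p. p \<in> J \<Longrightarrow> z p \<in> carrier_vec n" "\<And>p. p \<in> J \<Longrightarrow> t p \<ge> 0"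
  shows "det (gram_mat n c t z J) \<ge> c ^ n" "det (gram_mat n c t z J) > 0"
proof -
  show "det (gram_mat n c t z J) \<ge> c ^ n"
    using det_gram_mat_mono[of J "{}" c z n t] assms by (simp add: det_gram_mat_empty)
  then show "det (gram_mat n c t z J) > 0" using assms(2) zero_less_power[of c n] by linarith
qed

lemma det_gram_mat_ge:
  assumes "finite J" "c > 0" "\<And>p. p \<in> J \<Longrightarrow> z p \<in> carrier_vec n" "\<And>p. p \<in> J \<Longrightarrow> t p \<ge> 0" "p \<in> J"
  shows "det (gram_mat n c t z J) \<ge> c ^ n * (1 + t p * (z p \<bullet> z p) / c)"
proof -
  have "gram_mat n c t z {} *\<^sub>v (1 / c \<cdot>\<^sub>v z p) = z p"
    using assms(2) assms(3)[OF \<open>p \<in> J\<close>]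
    by (intro eq_vecI) (auto simp: gram_mat_def scalar_prod_def sum_divide_distrib[symmetric] if_distrib[of "\<lambda>x. x * _"] cong: if_cong)
  then have "det (gram_mat n c t z {p}) = c ^ n * (1 + t p * (z p \<bullet> z p) / c)"
    using det_gram_mat_insert[of "{}" p z n "1 / c \<cdot>\<^sub>v z p" c t] assms by (simp add: det_gram_mat_empty)
  moreover have "det (gram_mat n c t z {p}) > 0" using assms by (intro det_gram_mat_pos) auto
  ultimately show ?thesis using det_gram_mat_mono[of J "{p}" c z n t] assms by auto
qed

section \<open>Continuity, minimisation and singular matrices\<close>

text \<open>By the Leibniz formula the determinant is a polynomial in the entries.\<close>

lemma continuous_on_det:
  fixes A :: "'a :: topological_space \<Rightarrow> real mat"
  assumes "\<And>x. x \<in> S \<Longrightarrow> A x \<in> carrier_mat n n"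
    and "\<And>i j. i < n \<Longrightarrow> j < n \<Longrightarrow> continuous_on S (\<lambda>x. A x $$ (i, j))"
  shows "continuous_on S (\<lambda>x. det (A x))"
proof -
  have "continuous_on S (\<lambda>x. \<Sum>p | p permutes {0..<n}. signof p * (\<Prod>i = 0..<n. A x $$ (i, p i)))"
    using permutes_in_image by (intro continuous_intros assms(2)) fastforce+
  then show ?thesis
    using assms(1) by (subst continuous_on_cong[OF refl det_def'])
qed

text \<open>Tychonoff's theorem for a product of closed intervals.\<close>

lemma compact_box_fun: "compact (PiE UNIV (\<lambda>i :: 'a. {l i..u i :: real}))"
proof -
  have "compactin (product_topology (\<lambda>_. euclidean) UNIV) (PiE UNIV (\<lambda>i :: 'a. {l i..u i :: real}))"
    unfolding compactin_PiE by (auto simp: compactin_euclidean_iff)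
  then show ?thesis
    by (simp add: euclidean_product_topology compactin_euclidean_iff)
qed

text \<open>A pointwise maximum \<open>h\<close> of continuous functions \<open>g v\<close> is lower semicontinuous.\<close>

lemma compact_attains_inf_pointwise_max:
  fixes h :: "'a :: topological_space \<Rightarrow> real"
  assumes K: "compact K" "K \<noteq> {}"
    and cont: "\<And>v. v \<in> D \<Longrightarrow> continuous_on K (g v)"
    and le: "\<And>v s. v \<in> D \<Longrightarrow> s \<in> K \<Longrightarrow> g v s \<le> h s"
    and attained: "\<And>s. s \<in> K \<Longrightarrow> \<exists>v\<in>D. h s = g v s"
  shows "\<exists>s\<in>K. \<forall>t\<in>K. h s \<le> h t"
proof (rule ccontr)
  assume "\<not> ?thesis"
  then have "\<forall>s\<in>K. \<exists>t\<in>K. h t < h s" by force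
  then obtain t where t: "\<And>s. s \<in> K \<Longrightarrow> t s \<in> K \<and> h (t s) < h s" by metis
  obtain v where v: "\<And>s. s \<in> K \<Longrightarrow> v s \<in> D \<and> h s = g (v s) s" using attained by metis
  \<comment> \<open>If no minimum exists, every \<open>s\<close> is beaten by some
    \<open>t s\<close>. Near \<open>s\<close> the continuous minorant \<open>g (v s)\<close>, and
    hence \<open>h\<close>, still exceeds \<open>h (t s)\<close>.\<close>
  have "\<exists>U. open U \<and> U \<inter> K = g (v s) -` {h (t s)<..} \<inter> K" if "s \<in> K" for s
    using cont[of "v s"] v[OF that] unfolding continuous_on_open_invariant by auto
  then obtain U where U: "\<And>s. s \<in> K \<Longrightarrow> open (U s) \<and> U s \<inter> K = g (v s) -` {h (t s)<..} \<inter> K" by metis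
  have "K \<subseteq> (\<Union>s\<in>K. U s)"
  proof
    fix s assume s: "s \<in> K"
    then have "s \<in> g (v s) -` {h (t s)<..} \<inter> K" using t[OF s] v[OF s] by simp
    then show "s \<in> (\<Union>s\<in>K. U s)" using U[OF s] s by auto
  qed
  then obtain F where F: "F \<subseteq> K" "finite F" "K \<subseteq> (\<Union>s\<in>F. U s)"
    using compactE_image[OF K(1), of K U] U by metis
  then have "F \<noteq> {}" using K(2) by auto
  \<comment> \<open>The best of the finitely many \<open>t s\<close> lies in some
    \<open>U s'\<close>, where \<open>h\<close> exceeds \<open>h (t s')\<close>, which is at least
    \<open>\<mu>\<close>: a contradiction.\<close>
  define \<mu> where "\<mu> = Min ((\<lambda>s. h (t s)) ` F)"
  have "\<mu> \<in> (\<lambda>s. h (t s)) ` F" unfolding \<mu>_def using F \<open>F \<noteq> {}\<close> by (intro Min_in) auto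
  then obtain s where s: "s \<in> F" "h (t s) = \<mu>" by auto
  then have "t s \<in> K" using F t by auto
  then obtain s' where s': "s' \<in> F" "t s \<in> U s'" using F by auto
  then have "g (v s') (t s) > h (t s')" using U[of s'] F \<open>t s \<in> K\<close> by auto
  moreover have "\<mu> \<le> h (t s')" unfolding \<mu>_def using F s' by (intro Min_le) auto
  moreover have "g (v s') (t s) \<le> h (t s)" using le v s' F \<open>t s \<in> K\<close> by blast
  ultimately show False using s by linarith
qed

section \<open>Column spaces, singular Gram matrices and a scalar coercivity bound\<close>

lemma mult_mat_vec_vspan_cols:
  assumes "X \<in> carrier_mat n m"
  shows "b \<in> carrier_vec m \<Longrightarrow> X *\<^sub>v b \<in> vspan n (set (cols X))"
    and "x \<in> vspan n (set (cols X)) \<Longrightarrow> \<exists>b\<in>carrier_vec m. x = X *\<^sub>v b"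
proof -
  interpret vec_space "TYPE(real)" n .
  note eq = col_space_eq[OF assms, unfolded col_space_def]
  show "b \<in> carrier_vec m \<Longrightarrow> X *\<^sub>v b \<in> span (set (cols X))"
    unfolding eq using assms by auto
  show "x \<in> span (set (cols X)) \<Longrightarrow> \<exists>b\<in>carrier_vec m. x = X *\<^sub>v b"
    unfolding eq using assms by auto
qed

text \<open>The vectors become the first rows of a square matrix padded with zero rows. It is
  singular, and any kernel vector is orthogonal to all of them.\<close>

lemma exists_orthogonal_vec:
  fixes z :: "'p \<Rightarrow> real vec"
  assumes "finite J" "card J < n" "\<And>p. p \<in> J \<Longrightarrow> z p \<in> carrier_vec n"
  shows "\<exists>v\<in>carrier_vec n. v \<noteq> 0\<^sub>v n \<and> (\<forall>p\<in>J. z p \<bullet> v = 0)"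
proof -
  obtain f where f: "bij_betw f {0..<card J} J" using ex_bij_betw_nat_finite[OF assms(1)] by auto
  define M where "M = mat n n (\<lambda>(i, j). if i < card J then z (f i) $ j else 0)"
  have M: "M \<in> carrier_mat n n" by (simp add: M_def)
  \<comment> \<open>Row \<open>card J\<close> is the first padding row; it exists because
    \<open>card J < n\<close>.\<close>
  have "transpose_mat M *\<^sub>v unit_vec n (card J) = 0\<^sub>v n"
    using assms(2) by (intro eq_vecI) (auto simp: M_def)
  moreover have "unit_vec n (card J) \<noteq> (0\<^sub>v n :: real vec)"
    using assms(2) by (metis index_unit_vec(1) index_zero_vec(1) zero_neq_one)
  ultimately have "\<exists>v. v \<in> carrier_vec n \<and> v \<noteq> 0\<^sub>v n \<and> transpose_mat M *\<^sub>v v = 0\<^sub>v n"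
    by (intro exI[of _ "unit_vec n (card J)"]) auto
  then have "det (transpose_mat M) = 0"
    using M by (subst det_0_iff_vec_prod_zero[of _ n]) auto
  then have "det M = 0" using det_transpose[OF M] by simp
  then obtain v where v: "v \<in> carrier_vec n" "v \<noteq> 0\<^sub>v n" "M *\<^sub>v v = 0\<^sub>v n"
    using det_0_iff_vec_prod_zero[OF M] by auto
  have "z p \<bullet> v = 0" if "p \<in> J" for p
  proof -
    have "p \<in> f ` {0..<card J}" using that bij_betw_imp_surj_on[OF f] by simp
    then obtain i where i: "i < card J" "f i = p" by auto
    then have "(M *\<^sub>v v) $ i = z p \<bullet> v"
      using assms(2) assms(3)[OF that] v(1) by (auto simp: M_def scalar_prod_def intro!: sum.cong)
    then show ?thesis using v(3) i assms(2) by simp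
  qed
  then show ?thesis using v by blast
qed

text \<open>With \<open>c = 0\<close>, a nonzero vector orthogonal to all \<open>z p\<close> lies in
  the kernel.\<close>

lemma det_gram_mat_zero:
  assumes "finite J" "card J < n" "\<And>p. p \<in> J \<Longrightarrow> z p \<in> carrier_vec n"
  shows "det (gram_mat n 0 t z J) = 0"
proof -
  let ?G = "gram_mat n 0 t z J"
  obtain v where v: "v \<in> carrier_vec n" "v \<noteq> 0\<^sub>v n" "\<forall>p\<in>J. z p \<bullet> v = 0"
    using exists_orthogonal_vec[of J n z] assms by auto
  have "?G *\<^sub>v v \<in> carrier_vec n" by (rule mult_mat_vec_carrier[OF gram_mat_carrier(1) v(1)])
  \<comment> \<open>The vector \<open>G v\<close> is shown to vanish by testing the bilinear form
    against \<open>G v\<close> itself.\<close>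
  moreover from this have "(?G *\<^sub>v v) \<bullet> (?G *\<^sub>v v) = 0"
    using v assms by (subst gram_mat_bilinear) auto
  ultimately have "?G *\<^sub>v v = 0\<^sub>v n" using scalar_prod_self_real(2) by blast
  then show ?thesis using v det_0_iff_vec_prod_zero[of ?G n] by auto
qed

lemma index_finsum_mat:
  assumes "finite I" "\<And>i. i \<in> I \<Longrightarrow> f i \<in> carrier_mat nr nc"
  shows "finsum (module_mat TYPE('a :: comm_ring_1) nr nc) f I \<in> carrier_mat nr nc"
    and "a < nr \<Longrightarrow> b < nc \<Longrightarrow>
      finsum (module_mat TYPE('a) nr nc) f I $$ (a, b) = (\<Sum>i\<in>I. f i $$ (a, b))"
proof -
  interpret M: abelian_group "module_mat TYPE('a) nr nc" by (rule abelian_group_mat)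
  have "finsum (module_mat TYPE('a) nr nc) f I \<in> carrier_mat nr nc \<and>
    (\<forall>a<nr. \<forall>b<nc. finsum (module_mat TYPE('a) nr nc) f I $$ (a, b) = (\<Sum>i\<in>I. f i $$ (a, b)))"
    using assms
  proof (induction I rule: finite_induct)
    case empty
    show ?case by (simp add: module_mat_simps)
  next
    case (insert i I)
    have "f \<in> I \<rightarrow> carrier (module_mat TYPE('a) nr nc)" "f i \<in> carrier (module_mat TYPE('a) nr nc)"
      using insert.prems by (auto simp: module_mat_simps)
    from M.finsum_insert[OF insert.hyps(1,2) this] show ?case
      using insert by (auto simp: module_mat_simps)
  qed
  then show "finsum (module_mat TYPE('a) nr nc) f I \<in> carrier_mat nr nc"
    and "a < nr \<Longrightarrow> b < nc \<Longrightarrow>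
      finsum (module_mat TYPE('a) nr nc) f I $$ (a, b) = (\<Sum>i\<in>I. f i $$ (a, b))"
    by auto
qed

text \<open>For large \<open>c\<close> the logarithm dominates, which gives \<open>b\<close>. For
  small \<open>c\<close> half of \<open>d / c\<close> absorbs the negative logarithm, and the other
  half gives \<open>a\<close>.\<close>

lemma ln_plus_inverse_coercive:
  fixes d M :: real
  assumes "n > 0" "d > 0"
  shows "\<exists>a>0. \<exists>b. \<forall>c>0. real n * ln c + d / c \<le> M \<longrightarrow> a \<le> c \<and> c \<le> b"
proof -
  \<comment> \<open>An upper bound for \<open>d / (2 c)\<close>; the maximum with 1 makes it safe to
    divide by.\<close>
  define C where "C = max 1 (M + real n * ln (2 * real n / d))"
  have "d / (2 * C) \<le> c \<and> c \<le> exp (M / real n)" if c: "c > 0" and le: "real n * ln c + d / c \<le> M" for c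
  proof
    have "d / c > 0" using assms c by simp
    then have "real n * ln c \<le> M" using le by linarith
    then have "ln c \<le> M / real n" using assms by (simp add: field_simps)
    then show "c \<le> exp (M / real n)" using c by (simp add: ln_ge_iff[symmetric] ln_le_cancel_iff[symmetric] del: ln_le_cancel_iff)
    \<comment> \<open>The argument of \<open>ln x \<le> x - 1\<close> is chosen so that
      \<open>n\<close> times it is exactly half of \<open>d / c\<close>.\<close>
    have "ln (d / (2 * real n * c)) \<le> d / (2 * real n * c) - 1"
      using assms c by (intro ln_le_minus_one) auto
    moreover have "ln (d / (2 * real n * c)) = - ln (2 * real n / d) - ln c"
      using assms c by (simp add: ln_div ln_mult)
    ultimately have "- ln c \<le> d / (2 * real n * c) + ln (2 * real n / d)" by linarith
    then have "real n * (- ln c) \<le> real n * (d / (2 * real n * c) + ln (2 * real n / d))"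
      using assms by (intro mult_left_mono) auto
    also have "\<dots> = d / c / 2 + real n * ln (2 * real n / d)"
      using assms c by (simp add: field_simps)
    finally have "d / c / 2 \<le> M + real n * ln (2 * real n / d)" using le by linarith
    then have "d / c / 2 \<le> C" by (simp add: C_def)
    moreover have "C > 0" by (simp add: C_def)
    ultimately show "d / (2 * C) \<le> c" using c by (simp add: field_simps)
  qed
  moreover have "d / (2 * C) > 0" using assms by (simp add: C_def)
  ultimately show ?thesis by blast
qed

section \<open>The likelihood\<close>

locale variance_components =
  fixes n m r :: nat and k :: "nat \<Rightarrow> nat" and X :: "real mat" and Z :: "nat \<Rightarrow> real mat" and y :: "real vec"
  assumes X [simp]: "X \<in> carrier_mat n m"
    and Z: "\<And>i. i \<in> {1..r} \<Longrightarrow> Z i \<in> carrier_mat n (k i)"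
    and y [simp]: "y \<in> carrier_vec n"
begin

definition J :: "(nat \<times> nat) set" where "J = (SIGMA i:{1..r}. {..<k i})"

definition z :: "nat \<times> nat \<Rightarrow> real vec" where "z p = col (Z (fst p)) (snd p)"

text \<open>All columns of one \<open>Z i\<close> share the variance \<open>s i\<close>. Variances
  are functions on the naturals rather than vectors, so that the product topology and its compact
  boxes are available.\<close>

definition V :: "(nat \<Rightarrow> real) \<Rightarrow> real mat" where "V s = gram_mat n (s 0) (\<lambda>p. s (fst p)) z J"

definition objective :: "real vec \<Rightarrow> (nat \<Rightarrow> real) \<Rightarrow> real" where
  "objective b s = ln (det (V s)) + (y - X *\<^sub>v b) \<bullet> (the (mat_inverse (V s)) *\<^sub>v (y - X *\<^sub>v b))"

definition params :: "(nat \<Rightarrow> real) set" where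
  "params = {s. s 0 > 0 \<and> (\<forall>i\<in>{1..r}. s i \<ge> 0)}"

lemma finite_J [simp]: "finite J" by (auto simp: J_def)

lemma card_J: "card J = (\<Sum>i=1..r. k i)" by (simp add: J_def)

lemma z_carrier [simp]: "p \<in> J \<Longrightarrow> z p \<in> carrier_vec n"
  using Z[of "fst p"] by (auto simp: J_def z_def)

lemma cols_X [simp]: "set (cols X) \<subseteq> carrier_vec n"
  using cols_dim[of X] X by auto

lemma V_carrier [simp]: "V s \<in> carrier_mat n n" by (simp add: V_def)

lemma params_nonneg: "s \<in> params \<Longrightarrow> p \<in> J \<Longrightarrow> s (fst p) \<ge> 0"
  by (auto simp: params_def J_def)

text \<open>Entry by entry, \<open>Z i\<close> times its transpose is the sum of the outer products
  of its columns.\<close>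

lemma cov_mat_eq: "cov_mat n r Z s = V (\<lambda>i. s $ i)"
proof -
  let ?f = "\<lambda>i. s $ i \<cdot>\<^sub>m (Z i * transpose_mat (Z i))"
  have f: "?f i \<in> carrier_mat n n" if "i \<in> {1..r}" for i using Z[OF that] by auto
  note fs = index_finsum_mat[of "{1..r}" ?f n n, OF _ f]
  show ?thesis
  proof (intro eq_matI)
    fix a b assume "a < dim_row (V (\<lambda>i. s $ i))" "b < dim_col (V (\<lambda>i. s $ i))"
    then have ab: "a < n" "b < n" by (auto simp: V_def)
    have "(\<Sum>i=1..r. ?f i $$ (a, b)) = (\<Sum>i=1..r. \<Sum>j<k i. s $ i * (Z i $$ (a, j) * Z i $$ (b, j)))"
    proof (intro sum.cong refl)
      fix i assume "i \<in> {1..r}"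
      then show "?f i $$ (a, b) = (\<Sum>j<k i. s $ i * (Z i $$ (a, j) * Z i $$ (b, j)))"
        using Z[of i] ab by (auto simp: scalar_prod_def sum_distrib_left atLeast0LessThan)
    qed
    also have "\<dots> = (\<Sum>p\<in>J. s $ fst p * (z p $ a * z p $ b))"
    proof -
      have "z (i, j) $ a = Z i $$ (a, j)" if "i \<in> {1..r}" "j < k i" "a < n" for i j a
        using Z[OF that(1)] that by (simp add: z_def)
      then show ?thesis
        unfolding J_def using ab by (subst sum.Sigma) (auto intro!: sum.cong)
    qed
    finally show "cov_mat n r Z s $$ (a, b) = V (\<lambda>i. s $ i) $$ (a, b)"
      using ab fs by (auto simp: cov_mat_def V_def gram_mat_def)
  qed (use fs in \<open>auto simp: cov_mat_def V_def\<close>)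
qed

lemma neg2_loglik_eq: "neg2_loglik n r X Z b s y = objective b (\<lambda>i. s $ i)"
  by (simp add: neg2_loglik_def objective_def cov_mat_eq Let_def)

lemma param_space_eq: "(b, s) \<in> param_space m r \<longleftrightarrow>
    b \<in> carrier_vec m \<and> s \<in> carrier_vec (r + 1) \<and> (\<lambda>i. s $ i) \<in> params"
  by (auto simp: param_space_def params_def)

text \<open>This permits truncating a variance function to a vector of dimension
  \<open>r + 1\<close>.\<close>

lemma V_cong: "(\<And>i. i \<le> r \<Longrightarrow> s i = t i) \<Longrightarrow> V s = V t"
  unfolding V_def gram_mat_def by (intro eq_matI) (auto simp: J_def intro!: sum.cong)

lemma objective_cong: "V s = V t \<Longrightarrow> objective b s = objective b t"
  by (simp add: objective_def)

lemma joint_col_space_eq: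
  "joint_col_space n X (block_row n r Z) = vspan n (set (cols X) \<union> z ` J)"
proof -
  let ?vs = "concat (map (\<lambda>i. cols (Z i)) [1..<r + 1])"
  have "{1..<r + 1} = {1..r}" by auto
  then have "set ?vs = (\<Union>i\<in>{1..r}. set (cols (Z i)))"
    by (simp only: set_concat set_map set_upt image_image)
  also have "\<dots> = (\<Union>i\<in>{1..r}. (\<lambda>j. z (i, j)) ` {..<k i})"
    using carrier_matD(2)[OF Z] by (intro SUP_cong refl) (auto simp: cols_def z_def)
  also have "\<dots> = z ` J" by (auto simp: J_def)
  finally have vs: "set ?vs = z ` J" .
  then have "cols (mat_of_cols n ?vs) = ?vs" by (intro cols_mat_of_cols) auto
  then show ?thesis unfolding joint_col_space_def block_row_def using vs by simp
qed

section \<open>Unboundedness below when \<open>y\<close> lies in the joint column space\<close>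

lemma Xb_carrier [simp]: "b \<in> carrier_vec m \<Longrightarrow> X *\<^sub>v b \<in> carrier_vec n"
  using X by (rule mult_mat_vec_carrier)

lemma X_zero [simp]: "X *\<^sub>v 0\<^sub>v m = 0\<^sub>v n"
  using X carrier_matD[OF X] by (intro eq_vecI) auto

lemma residual_carrier [simp]: "b \<in> carrier_vec m \<Longrightarrow> y - X *\<^sub>v b \<in> carrier_vec n"
  by simp

lemma V_sym:
  assumes u: "u \<in> carrier_vec n" and v: "v \<in> carrier_vec n"
  shows "u \<bullet> (V s *\<^sub>v v) = v \<bullet> (V s *\<^sub>v u)"
  using u v comm_scalar_prod[OF u v] by (simp add: V_def gram_mat_bilinear mult.commute)

text \<open>For \<open>x = X b + \<Sum> w p z p\<close> this is Cauchy-Schwarz with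
  \<open>C = |w|^2\<close>. Induction over the span avoids explicit coefficients: a column of
  \<open>X\<close> costs 0, a column of \<open>Z\<close> costs 1, a sum \<open>2 C + 2 C'\<close>, a
  multiple \<open>c^2 C\<close>.\<close>

lemma bounded_residual:
  assumes "x \<in> vspan n (set (cols X) \<union> z ` J)"
  shows "\<exists>b\<in>carrier_vec m. \<exists>C. \<forall>v\<in>carrier_vec n.
    (v \<bullet> (x - X *\<^sub>v b))\<^sup>2 \<le> C * (\<Sum>p\<in>J. (z p \<bullet> v)\<^sup>2)"
proof -
  have sub: "set (cols X) \<union> z ` J \<subseteq> carrier_vec n" using cols_X z_carrier by blast
  from assms sub show ?thesis
  proof (induction rule: vspan_induct)
    case zero
    show ?case by (intro bexI[of _ "0\<^sub>v m"] exI[of _ 0]) auto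
  next
    case (base x)
    show ?case
    proof (cases "x \<in> set (cols X)")
      case True
      then obtain b where b: "b \<in> carrier_vec m" "x = X *\<^sub>v b"
        using mult_mat_vec_vspan_cols(2)[OF X] vspan_base[OF cols_X] by blast
      have "x - X *\<^sub>v b = 0\<^sub>v n" unfolding b(2) using Xb_carrier[OF b(1)] by simp
      then show ?thesis by (intro bexI[OF _ b(1)] exI[of _ 0]) simp
    next
      case False
      then obtain p where p: "p \<in> J" "x = z p" using base by auto
      have "x - X *\<^sub>v 0\<^sub>v m = x" using z_carrier[OF p(1)] p by simp
      moreover have "(v \<bullet> z p)\<^sup>2 \<le> 1 * (\<Sum>p\<in>J. (z p \<bullet> v)\<^sup>2)" if "v \<in> carrier_vec n" for v
        using member_le_sum[of p J "\<lambda>p. (z p \<bullet> v)\<^sup>2"] p comm_scalar_prod[OF that z_carrier[OF p(1)]] by simp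
      ultimately show ?thesis using p by (intro bexI[of _ "0\<^sub>v m"] exI[of _ 1]) auto
    qed
  next
    case (add x x')
    obtain b C where b: "b \<in> carrier_vec m"
      "\<forall>v\<in>carrier_vec n. (v \<bullet> (x - X *\<^sub>v b))\<^sup>2 \<le> C * (\<Sum>p\<in>J. (z p \<bullet> v)\<^sup>2)" using add by auto
    obtain b' C' where b': "b' \<in> carrier_vec m"
      "\<forall>v\<in>carrier_vec n. (v \<bullet> (x' - X *\<^sub>v b'))\<^sup>2 \<le> C' * (\<Sum>p\<in>J. (z p \<bullet> v)\<^sup>2)" using add by auto
    have "(v \<bullet> (x + x' - X *\<^sub>v (b + b')))\<^sup>2 \<le> (2 * C + 2 * C') * (\<Sum>p\<in>J. (z p \<bullet> v)\<^sup>2)"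
      if v: "v \<in> carrier_vec n" for v
    proof -
      have "x + x' - X *\<^sub>v (b + b') = (x - X *\<^sub>v b) + (x' - X *\<^sub>v b')"
        unfolding mult_add_distrib_mat_vec[OF X b(1) b'(1)]
        using add(1,2) X carrier_matD(1)[OF X] by (intro eq_vecI) auto
      then have "v \<bullet> (x + x' - X *\<^sub>v (b + b')) = v \<bullet> (x - X *\<^sub>v b) + v \<bullet> (x' - X *\<^sub>v b')"
        using v add(1,2) b(1) b'(1) by (simp add: scalar_prod_add_distrib[of _ n])
      \<comment> \<open>The inequality \<open>(a + a')^2 \<le> 2 a^2 + 2 a'^2\<close>, from the
        square of the difference.\<close>
      then have "(v \<bullet> (x + x' - X *\<^sub>v (b + b')))\<^sup>2 \<le> 2 * (v \<bullet> (x - X *\<^sub>v b))\<^sup>2 + 2 * (v \<bullet> (x' - X *\<^sub>v b'))\<^sup>2"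
        using sum_squares_ge_zero[of "v \<bullet> (x - X *\<^sub>v b) - v \<bullet> (x' - X *\<^sub>v b')" 0]
        by (simp add: power2_eq_square algebra_simps)
      also have "\<dots> \<le> 2 * (C * (\<Sum>p\<in>J. (z p \<bullet> v)\<^sup>2)) + 2 * (C' * (\<Sum>p\<in>J. (z p \<bullet> v)\<^sup>2))"
        using b b' v by (intro add_mono mult_left_mono) auto
      finally show ?thesis by (simp add: algebra_simps)
    qed
    then show ?case using b b' by (intro bexI[of _ "b + b'"] exI[of _ "2 * C + 2 * C'"]) auto
  next
    case (smult c x)
    obtain b C where b: "b \<in> carrier_vec m"
      "\<forall>v\<in>carrier_vec n. (v \<bullet> (x - X *\<^sub>v b))\<^sup>2 \<le> C * (\<Sum>p\<in>J. (z p \<bullet> v)\<^sup>2)" using smult by auto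
    have "(v \<bullet> (c \<cdot>\<^sub>v x - X *\<^sub>v (c \<cdot>\<^sub>v b)))\<^sup>2 \<le> (c\<^sup>2 * C) * (\<Sum>p\<in>J. (z p \<bullet> v)\<^sup>2)"
      if v: "v \<in> carrier_vec n" for v
    proof -
      have "c \<cdot>\<^sub>v x - X *\<^sub>v (c \<cdot>\<^sub>v b) = c \<cdot>\<^sub>v (x - X *\<^sub>v b)"
        unfolding mult_mat_vec[OF X b(1)]
        using smult(1) carrier_matD(1)[OF X] by (intro eq_vecI) (auto simp: algebra_simps)
      then have "v \<bullet> (c \<cdot>\<^sub>v x - X *\<^sub>v (c \<cdot>\<^sub>v b)) = c * (v \<bullet> (x - X *\<^sub>v b))"
        using v smult(1) b(1) by simp
      then show ?thesis
        using mult_left_mono[of "(v \<bullet> (x - X *\<^sub>v b))\<^sup>2" "C * (\<Sum>p\<in>J. (z p \<bullet> v)\<^sup>2)" "c\<^sup>2"] b v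
        by (simp add: power_mult_distrib mult.assoc)
    qed
    then show ?case using b by (intro bexI[of _ "c \<cdot>\<^sub>v b"] exI[of _ "c\<^sup>2 * C"]) auto
  qed
qed

lemma objective_ge_dual:
  assumes "s \<in> params" "b \<in> carrier_vec m" "v \<in> carrier_vec n"
  shows "ln (det (V s)) + 2 * (v \<bullet> (y - X *\<^sub>v b)) - v \<bullet> (V s *\<^sub>v v) \<le> objective b s"
  using gram_mat_dual(1)[of J z n "\<lambda>p. s (fst p)" "s 0" "y - X *\<^sub>v b" v] assms params_nonneg[OF assms(1)]
  by (auto simp: objective_def V_def params_def)

lemma continuous_on_V: "continuous_on S (\<lambda>s. V s $$ (i, j))" if "i < n" "j < n"
proof -
  have coord: "continuous_on S (\<lambda>s :: nat \<Rightarrow> real. s l)" for l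
    by (rule continuous_on_subset[OF continuous_on_product_coordinates subset_UNIV])
  have "continuous_on S (\<lambda>s :: nat \<Rightarrow> real. (if i = j then s 0 else 0) + (\<Sum>p\<in>J. s (fst p) * (z p $ i * z p $ j)))"
    by (cases "i = j") (auto intro!: continuous_intros coord)
  then show ?thesis using that by (simp add: V_def gram_mat_def)
qed

text \<open>The quadratic form is bounded by a \<open>D\<close> independent of
  \<open>\<epsilon>\<close>, so it suffices to choose \<open>\<epsilon>\<close> with
  \<open>ln (det V) < l - D\<close>.\<close>

lemma objective_unbounded_below:
  assumes K: "(\<Sum>i=1..r. k i) < n" and y_in: "y \<in> vspan n (set (cols X) \<union> z ` J)"
  shows "\<exists>b\<in>carrier_vec m. \<exists>s\<in>params. objective b s < l"
proof -
  obtain b C where b: "b \<in> carrier_vec m"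
    and C: "\<And>v. v \<in> carrier_vec n \<Longrightarrow> (v \<bullet> (y - X *\<^sub>v b))\<^sup>2 \<le> C * (\<Sum>p\<in>J. (z p \<bullet> v)\<^sup>2)"
    using bounded_residual[OF y_in] by blast
  define D where "D = max 1 C"
  define s where "s \<epsilon> = (\<lambda>i :: nat. if i = 0 then \<epsilon> else (1 :: real))" for \<epsilon>
  have V_s: "V (s \<epsilon>) = gram_mat n \<epsilon> (\<lambda>_. 1) z J" for \<epsilon>
    unfolding V_def s_def gram_mat_def by (intro eq_matI) (auto simp: J_def intro!: sum.cong)
  have "continuous_on UNIV (\<lambda>\<epsilon>. det (V (s \<epsilon>)))"
  proof (intro continuous_on_det)
    fix i j assume "i < n" "j < n"
    have "continuous_on UNIV (\<lambda>\<epsilon>. (if i = j then \<epsilon> else 0) + (\<Sum>p\<in>J. 1 * (z p $ i * z p $ j)))"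
      by (cases "i = j") (auto intro!: continuous_intros)
    then show "continuous_on UNIV (\<lambda>\<epsilon>. V (s \<epsilon>) $$ (i, j))"
      using \<open>i < n\<close> \<open>j < n\<close> by (simp add: V_s gram_mat_def)
  qed auto
  moreover have "det (V (s 0)) = 0"
    unfolding V_s using K by (intro det_gram_mat_zero) (auto simp: card_J)
  ultimately have "((\<lambda>\<epsilon>. det (V (s \<epsilon>))) \<longlongrightarrow> 0) (at 0)"
    unfolding continuous_on_def by (metis UNIV_I)
  then have "((\<lambda>\<epsilon>. det (V (s \<epsilon>))) \<longlongrightarrow> 0) (at_right 0)"
    by (rule tendsto_mono[OF at_le[OF subset_UNIV]])
  then have "\<forall>\<^sub>F \<epsilon> in at_right 0. det (V (s \<epsilon>)) < exp (l - D)"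
    by (intro order_tendstoD) auto
  then have "\<forall>\<^sub>F \<epsilon> in at_right 0. \<epsilon> > 0 \<and> det (V (s \<epsilon>)) < exp (l - D)"
    by (intro eventually_conj eventually_at_right_less)
  then obtain \<epsilon> where \<epsilon>: "\<epsilon> > 0" "det (V (s \<epsilon>)) < exp (l - D)"
    using eventually_happens'[OF trivial_limit_at_right_real] by blast
  let ?e = "y - X *\<^sub>v b"
  define w where "w = the (mat_inverse (V (s \<epsilon>))) *\<^sub>v ?e"
  define Q where "Q = (\<Sum>p\<in>J. (z p \<bullet> w)\<^sup>2)"
  have Q: "Q \<ge> 0" by (auto simp: Q_def intro!: sum_nonneg)
  have e: "?e \<in> carrier_vec n" using b by simp
  note d = gram_mat_dual[where J = J and z = z and n = n and t = "\<lambda>_. 1" and c = \<epsilon> and e = ?e, folded V_s, folded w_def]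
  have w: "w \<in> carrier_vec n" unfolding w_def V_s using \<epsilon> e by (intro gram_mat_dual(3)) auto
  \<comment> \<open>By duality the quadratic form is \<open>2 w' e - w' V w\<close>. The subtracted
    term is at least \<open>Q\<close>, and \<open>2 w' e \<le> D + Q\<close> follows from
    \<open>(w' e)^2 \<le> C Q\<close> and \<open>4 D Q \<le> (D + Q)^2\<close>; so \<open>Q\<close>
    cancels.\<close>
  have "w \<bullet> (V (s \<epsilon>) *\<^sub>v w) = \<epsilon> * (w \<bullet> w) + Q"
    unfolding V_s using w by (subst gram_mat_bilinear) (auto simp: Q_def power2_eq_square)
  then have "w \<bullet> (V (s \<epsilon>) *\<^sub>v w) \<ge> Q" using scalar_prod_self_real(1)[OF w] \<epsilon> by simp
  moreover have "2 * (w \<bullet> ?e) \<le> D + Q"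
  proof (rule power2_le_imp_le)
    have "(2 * (w \<bullet> ?e))\<^sup>2 \<le> 4 * (C * Q)" using C[OF w] by (simp add: Q_def power_mult_distrib)
    also have "\<dots> \<le> 4 * (D * Q)" using Q by (intro mult_left_mono mult_right_mono) (auto simp: D_def)
    also have "\<dots> \<le> (D + Q)\<^sup>2"
      using zero_le_power2[of "D - Q"] by (simp add: power2_eq_square algebra_simps)
    finally show "(2 * (w \<bullet> ?e))\<^sup>2 \<le> (D + Q)\<^sup>2" .
    show "0 \<le> D + Q" using Q by (simp add: D_def)
  qed
  ultimately have "?e \<bullet> w \<le> D" using d(2) \<epsilon> e by auto
  moreover have "det (V (s \<epsilon>)) > 0" unfolding V_s using \<epsilon> by (intro det_gram_mat_pos) auto
  then have "ln (det (V (s \<epsilon>))) < l - D" using \<epsilon>(2) ln_less_cancel_iff[of "det (V (s \<epsilon>))" "exp (l - D)"] by simp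
  ultimately have "objective b (s \<epsilon>) < l" by (simp add: objective_def w_def)
  moreover have "s \<epsilon> \<in> params" using \<epsilon> by (auto simp: params_def s_def)
  ultimately show ?thesis using b by blast
qed

section \<open>Profile likelihood and attainment of the minimum off the joint column space\<close>

text \<open>Generalised least squares, with \<open>w\<close> the weighted residual \<open>V\<^sup>-\<^sup>1 (y - X b)\<close>.\<close>

lemma exists_gls:
  assumes s: "s \<in> params"
  shows "\<exists>b\<in>carrier_vec m. \<exists>w\<in>carrier_vec n. (\<forall>x\<in>set (cols X). x \<bullet> w = 0) \<and>
    objective b s = ln (det (V s)) + 2 * (w \<bullet> (y - X *\<^sub>v b)) - w \<bullet> (V s *\<^sub>v w)"
proof -
  let ?W = "the (mat_inverse (V s))"
  have pos: "s 0 > 0" using s by (simp add: params_def)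
  note nn = params_nonneg[OF s]
  have W: "?W \<in> carrier_mat n n"
    unfolding V_def using gram_mat_inverse(1)[of J z n "\<lambda>p. s (fst p)" "s 0"] nn pos by auto
  have VW: "V s *\<^sub>v (?W *\<^sub>v e) = e" if "e \<in> carrier_vec n" for e
    unfolding V_def using gram_mat_inverse(2)[of J z n "\<lambda>p. s (fst p)" "s 0" e] nn pos that by auto
  have We: "?W *\<^sub>v e \<in> carrier_vec n" if "e \<in> carrier_vec n" for e using W that by auto
  have sym: "u \<bullet> (?W *\<^sub>v v) = v \<bullet> (?W *\<^sub>v u)" if "u \<in> carrier_vec n" "v \<in> carrier_vec n" for u v
  proof -
    have "(?W *\<^sub>v v) \<bullet> (V s *\<^sub>v (?W *\<^sub>v u)) = (?W *\<^sub>v u) \<bullet> (V s *\<^sub>v (?W *\<^sub>v v))"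
      by (rule V_sym[OF We[OF that(2)] We[OF that(1)]])
    then have "(?W *\<^sub>v v) \<bullet> u = (?W *\<^sub>v u) \<bullet> v" by (simp only: VW that)
    then show ?thesis
      using comm_scalar_prod[OF that(1) We[OF that(2)]] comm_scalar_prod[OF that(2) We[OF that(1)]] by simp
  qed
  \<comment> \<open>Definiteness passes from \<open>V\<close> to its inverse through the vector
    \<open>V^-1 v\<close>.\<close>
  have pd: "v = 0\<^sub>v n" if v: "v \<in> carrier_vec n" "v \<bullet> (?W *\<^sub>v v) = 0" for v
  proof -
    have "(?W *\<^sub>v v) \<bullet> (V s *\<^sub>v (?W *\<^sub>v v)) = 0"
      using comm_scalar_prod[OF v(1) We[OF v(1)]] v(2) by (simp only: VW[OF v(1)])
    then have "?W *\<^sub>v v = 0\<^sub>v n"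
      using gram_mat_pos_def(2)[of J z n "\<lambda>p. s (fst p)" "?W *\<^sub>v v" "s 0"] We[OF v(1)] nn pos
      by (auto simp: V_def)
    then have "v = V s *\<^sub>v 0\<^sub>v n" using VW[OF v(1)] by simp
    then show ?thesis by (auto simp: V_def intro!: eq_vecI)
  qed
  \<comment> \<open>Projecting \<open>y\<close> in the inner product of \<open>V^-1\<close> makes
    the weighted residual \<open>V^-1 (y - x)\<close> orthogonal, in the Euclidean sense, to the
    columns of \<open>X\<close>.\<close>
  obtain x where x: "x \<in> vspan n (set (cols X))" "\<forall>c\<in>set (cols X). c \<bullet> (?W *\<^sub>v (y - x)) = 0"
  proof -
    have "\<exists>x\<in>vspan n (set (cols X)). \<forall>c\<in>set (cols X). c \<bullet> (?W *\<^sub>v (y - x)) = 0"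
      by (rule orthogonal_projection[OF W]) (simp_all only: sym pd finite_set cols_X y)
    then show ?thesis using that by blast
  qed
  obtain b where b: "b \<in> carrier_vec m" "x = X *\<^sub>v b" using mult_mat_vec_vspan_cols(2)[OF X x(1)] by auto
  have yx: "y - x \<in> carrier_vec n" using b by simp
  have "2 * ((?W *\<^sub>v (y - x)) \<bullet> (y - x)) - (?W *\<^sub>v (y - x)) \<bullet> (V s *\<^sub>v (?W *\<^sub>v (y - x))) = (y - x) \<bullet> (?W *\<^sub>v (y - x))"
    unfolding V_def by (rule gram_mat_dual(2)) (use yx nn pos in auto)
  then have "objective b s = ln (det (V s)) + 2 * ((?W *\<^sub>v (y - x)) \<bullet> (y - X *\<^sub>v b)) - (?W *\<^sub>v (y - x)) \<bullet> (V s *\<^sub>v (?W *\<^sub>v (y - x)))"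
    unfolding objective_def b(2)[symmetric] by linarith
  then show ?thesis using b(1) x(2) We[OF yx] by (intro bexI[of _ b] bexI[of _ "?W *\<^sub>v (y - x)"] conjI)
qed

text \<open>For dual vectors orthogonal to \<open>X\<close> the dual bound becomes independent of
  \<open>b\<close>, hence a bound on the profile in the variances.\<close>

lemma orthogonal_to_cols:
  assumes "v \<in> carrier_vec n" "\<forall>x\<in>set (cols X). x \<bullet> v = 0" "b \<in> carrier_vec m"
  shows "v \<bullet> (y - X *\<^sub>v b) = v \<bullet> y"
proof -
  have Xb: "X *\<^sub>v b \<in> carrier_vec n" using assms(3) by simp
  have "(X *\<^sub>v b) \<bullet> (1\<^sub>m n *\<^sub>v v) = 0"
    by (rule vspan_orthogonal[OF _ cols_X assms(1)]) (use assms mult_mat_vec_vspan_cols(1)[OF X] in auto)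
  then have "v \<bullet> (X *\<^sub>v b) = 0" using assms(1) comm_scalar_prod[OF assms(1) Xb] by simp
  then show ?thesis using assms Xb by (simp add: scalar_prod_minus_distrib[of _ n])
qed

text \<open>Here \<open>d = |u|^2\<close> for the Euclidean residual \<open>u\<close> of
  \<open>y\<close>, which is nonzero because \<open>y\<close> is outside the span.\<close>

lemma objective_lower_bound:
  assumes y_notin: "y \<notin> vspan n (set (cols X) \<union> z ` J)"
  shows "\<exists>d>0. \<forall>b\<in>carrier_vec m. \<forall>s\<in>params. ln (det (V s)) + d / s 0 \<le> objective b s"
proof -
  let ?S = "set (cols X) \<union> z ` J"
  have S: "?S \<subseteq> carrier_vec n" using cols_X z_carrier by blast
  obtain x where x: "x \<in> vspan n ?S" "\<forall>c\<in>?S. c \<bullet> (1\<^sub>m n *\<^sub>v (y - x)) = 0"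
  proof -
    have "\<exists>x\<in>vspan n ?S. \<forall>c\<in>?S. c \<bullet> (1\<^sub>m n *\<^sub>v (y - x)) = 0"
      by (rule orthogonal_projection) (use S comm_scalar_prod scalar_prod_self_real(2) in auto)
    then show ?thesis using that by blast
  qed
  have xc: "x \<in> carrier_vec n" using vspan_carrier[OF S x(1)] .
  define u where "u = y - x"
  have u: "u \<in> carrier_vec n" using xc by (simp add: u_def)
  have perp: "c \<bullet> u = 0" if "c \<in> ?S" for c using x(2) that u by (auto simp: u_def[symmetric])
  have "x \<bullet> (1\<^sub>m n *\<^sub>v u) = 0"
    using x by (intro vspan_orthogonal[OF _ S u]) (auto simp: u_def)
  then have "u \<bullet> x = 0" using u comm_scalar_prod[OF u xc] by simp
  moreover have "u \<bullet> u = u \<bullet> y - u \<bullet> x" 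
    using scalar_prod_minus_distrib[OF u y xc] by (simp add: u_def)
  ultimately have uy: "u \<bullet> y = u \<bullet> u" by simp
  have "u \<noteq> 0\<^sub>v n"
  proof
    assume "u = 0\<^sub>v n"
    moreover have "y = u + x" using xc y by (intro eq_vecI) (auto simp: u_def)
    ultimately have "y = x" using xc by simp
    then show False using x y_notin by simp
  qed
  then have d: "u \<bullet> u > 0" using scalar_prod_self_real[OF u] by simp
  have "ln (det (V s)) + (u \<bullet> u) / s 0 \<le> objective b s" if b: "b \<in> carrier_vec m" and s: "s \<in> params" for b s
  proof -
    \<comment> \<open>The best dual vector among multiples of \<open>u\<close>: since
      \<open>u\<close> is orthogonal to every \<open>z p\<close>, \<open>u' V u\<close> is just
      \<open>s 0 * |u|^2\<close>.\<close>
    let ?v = "1 / s 0 \<cdot>\<^sub>v u"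
    have pos: "s 0 > 0" using s by (simp add: params_def)
    have v: "?v \<in> carrier_vec n" using u by simp
    have "u \<bullet> (y - X *\<^sub>v b) = u \<bullet> u"
      using orthogonal_to_cols[OF u _ b] perp uy by auto
    then have "?v \<bullet> (y - X *\<^sub>v b) = (u \<bullet> u) / s 0"
      using u b by (subst smult_scalar_prod_distrib[of _ n]) auto
    moreover have "?v \<bullet> (V s *\<^sub>v ?v) = (u \<bullet> u) / s 0"
      unfolding V_def using v u pos perp by (subst gram_mat_bilinear) auto
    ultimately show ?thesis using objective_ge_dual[OF s b v] by simp
  qed
  then show ?thesis using d by blast
qed

lemma objective_attains_inf:
  assumes n: "n > 0" and y_notin: "y \<notin> vspan n (set (cols X) \<union> z ` J)"
  shows "\<exists>b\<in>carrier_vec m. \<exists>s\<in>params. \<forall>b'\<in>carrier_vec m. \<forall>s'\<in>params. objective b s \<le> objective b' s'"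
proof -
  obtain d where d: "d > 0" and lower: "\<And>b s. b \<in> carrier_vec m \<Longrightarrow> s \<in> params \<Longrightarrow> ln (det (V s)) + d / s 0 \<le> objective b s"
    using objective_lower_bound[OF y_notin] by blast
  \<comment> \<open>The admissible dual vectors; \<open>g v\<close> is the dual bound they give,
    free of \<open>b\<close>.\<close>
  define D where "D = {v \<in> carrier_vec n. \<forall>x\<in>set (cols X). x \<bullet> v = 0}"
  define g where "g v s = ln (det (V s)) + 2 * (v \<bullet> y) - v \<bullet> (V s *\<^sub>v v)" for v s
  have "\<exists>b\<in>carrier_vec m. \<exists>w\<in>D. objective b s = g w s" if s: "s \<in> params" for s
  proof -
    obtain b w where "b \<in> carrier_vec m" "w \<in> carrier_vec n" "\<forall>x\<in>set (cols X). x \<bullet> w = 0"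
      "objective b s = ln (det (V s)) + 2 * (w \<bullet> (y - X *\<^sub>v b)) - w \<bullet> (V s *\<^sub>v w)"
      using exists_gls[OF s] by blast
    then show ?thesis using orthogonal_to_cols[of w b] by (auto simp: D_def g_def)
  qed
  \<comment> \<open>\<open>\<beta> s\<close> is a generalised least squares solution at
    \<open>s\<close>, where a dual vector attains equality; so \<open>h\<close> below is the
    profile.\<close>
  then obtain \<beta> where \<beta>: "\<And>s. s \<in> params \<Longrightarrow> \<beta> s \<in> carrier_vec m \<and> (\<exists>w\<in>D. objective (\<beta> s) s = g w s)"
    by metis
  define h where "h s = objective (\<beta> s) s" for s
  have g_le: "g v s \<le> objective b s" if "v \<in> D" "s \<in> params" "b \<in> carrier_vec m" for v s b
  proof -
    have "v \<in> carrier_vec n" "v \<bullet> (y - X *\<^sub>v b) = v \<bullet> y"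
      using orthogonal_to_cols[OF _ _ that(3)] that(1) by (auto simp: D_def)
    then show ?thesis using objective_ge_dual[OF that(2,3)] unfolding g_def by metis
  qed
  have h_le: "h s \<le> objective b s" if "s \<in> params" "b \<in> carrier_vec m" for s b
    using \<beta>[OF that(1)] g_le[OF _ that] by (auto simp: h_def)
  have det_pos: "det (V s) > 0" "det (V s) \<ge> s 0 ^ n" if "s \<in> params" for s
    unfolding V_def using params_nonneg[OF that] that
    by (auto simp: params_def intro!: det_gram_mat_pos)
  have ln_det: "ln (det (V s)) \<ge> n * ln (s 0)" if s: "s \<in> params" for s
  proof -
    have "s 0 > 0" using s by (simp add: params_def)
    then show ?thesis
      using det_pos[OF s] by (simp add: ln_realpow[symmetric])
  qed
  have ln_det': "ln (det (V s)) \<ge> n * ln (s 0) + ln (1 + s (fst p) * (z p \<bullet> z p) / s 0)"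
    if s: "s \<in> params" and p: "p \<in> J" for s p
  proof -
    have pos: "s 0 > 0" using s by (simp add: params_def)
    have pos': "1 + s (fst p) * (z p \<bullet> z p) / s 0 > 0"
      using params_nonneg[OF s p] pos scalar_prod_self_real(1)[OF z_carrier[OF p]]
      by (intro add_pos_nonneg divide_nonneg_pos mult_nonneg_nonneg) auto
    have "s 0 ^ n * (1 + s (fst p) * (z p \<bullet> z p) / s 0) \<le> det (V s)"
      unfolding V_def by (rule det_gram_mat_ge) (use params_nonneg[OF s] pos p in auto)
    then have "ln (s 0 ^ n * (1 + s (fst p) * (z p \<bullet> z p) / s 0)) \<le> ln (det (V s))"
      using pos pos' by (intro ln_mono) auto
    then show ?thesis using pos pos' by (simp add: ln_mult ln_realpow)
  qed

  \<comment> \<open>A reference point with unit error variance and no random effects. Its profile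
    value \<open>M\<close> is the level that competitors have to reach.\<close>
  define s0 where "s0 = (\<lambda>i :: nat. if i = 0 then (1 :: real) else 0)"
  have s0: "s0 \<in> params" by (simp add: s0_def params_def)
  define M where "M = h s0"
  obtain a b where a: "a > 0" and ab: "\<And>c. c > 0 \<Longrightarrow> n * ln c + d / c \<le> M \<Longrightarrow> a \<le> c \<and> c \<le> b"
    using ln_plus_inverse_coercive[OF n d, of M] by blast
  \<comment> \<open>\<open>E\<close> bounds \<open>1 + s i * |z|^2 / s 0\<close> at level
    \<open>M\<close>, so \<open>s i \<le> b * E / |z|^2\<close> for each nonzero column
    \<open>z\<close> of \<open>Z i\<close>. Summing over columns gives one bound \<open>u i\<close>
    without choosing a column.\<close>
  define E where "E = exp (M - n * ln a)"
  \<comment> \<open>Zero columns do not constrain the variance; they contribute \<open>1 / 0 = 0\<close> to this bound.\<close>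
  define u where "u i = (if i = 0 then b else if i \<le> r then b * E * (\<Sum>j<k i. 1 / (z (i, j) \<bullet> z (i, j))) else 0)" for i
  \<comment> \<open>Keeping \<open>s 0 \<ge> a > 0\<close> places the box inside
    \<open>params\<close>; coordinates beyond \<open>r\<close> are confined to
    \<open>{0..0}\<close>.\<close>
  define K where "K = PiE UNIV (\<lambda>i. {(if i = 0 then a else 0)..u i})"
  have box: "a \<le> s 0 \<and> s 0 \<le> b \<and> (\<forall>p\<in>J. z p \<noteq> 0\<^sub>v n \<longrightarrow> s (fst p) \<le> u (fst p))"
    if s: "s \<in> params" and c: "c \<in> carrier_vec m" and le: "objective c s \<le> M" for s c
  proof (intro conjI ballI impI)
    have pos: "s 0 > 0" using s by (simp add: params_def)
    have "n * ln (s 0) + d / s 0 \<le> M" using lower[OF c s] ln_det[OF s] le by linarith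
    then show as: "a \<le> s 0" and sb: "s 0 \<le> b" using ab[OF pos] by auto
    fix p assume p: "p \<in> J" and "z p \<noteq> 0\<^sub>v n"
    then have zp: "z p \<bullet> z p > 0" using scalar_prod_self_real[OF z_carrier[OF p]] by auto
    have q: "s (fst p) * (z p \<bullet> z p) / s 0 \<ge> 0" using params_nonneg[OF s p] zp pos by simp
    have "n * ln a \<le> n * ln (s 0)" using as a by (intro mult_left_mono ln_mono) auto
    moreover have "d / s 0 \<ge> 0" using d pos by simp
    ultimately have "ln (1 + s (fst p) * (z p \<bullet> z p) / s 0) \<le> M - n * ln a"
      using lower[OF c s] ln_det'[OF s p] le by linarith
    then have "1 + s (fst p) * (z p \<bullet> z p) / s 0 \<le> E"
      unfolding E_def using q by (subst ln_le_cancel_iff[symmetric]) auto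
    then have "s (fst p) * (z p \<bullet> z p) / s 0 \<le> E" by simp
    then have "s (fst p) \<le> s 0 * E * (1 / (z p \<bullet> z p))" using pos zp by (simp add: field_simps)
    also have "\<dots> \<le> b * E * (1 / (z p \<bullet> z p))"
      using sb zp by (intro mult_right_mono) (auto simp: E_def)
    also have "1 / (z p \<bullet> z p) \<le> (\<Sum>j<k (fst p). 1 / (z (fst p, j) \<bullet> z (fst p, j)))"
      using member_le_sum[of "snd p" "{..<k (fst p)}" "\<lambda>j. 1 / (z (fst p, j) \<bullet> z (fst p, j))"] p
        scalar_prod_self_real(1)[OF z_carrier]
      by (auto simp: J_def)
    then have "b * E * (1 / (z p \<bullet> z p)) \<le> b * E * (\<Sum>j<k (fst p). 1 / (z (fst p, j) \<bullet> z (fst p, j)))"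
      using pos sb by (intro mult_left_mono) (auto simp: E_def)
    also have "\<dots> = u (fst p)" using p by (auto simp: u_def J_def)
    finally show "s (fst p) \<le> u (fst p)" .
  qed
  \<comment> \<open>The point \<open>s0\<close> itself reaches level \<open>M\<close>, so its error
    variance 1 obeys the box bounds.\<close>
  have "a \<le> 1" "1 \<le> b"
    using box[OF s0, of "\<beta> s0"] \<beta>[OF s0] by (auto simp: M_def h_def s0_def)
  have u_nonneg: "u i \<ge> 0" for i
    using \<open>1 \<le> b\<close> scalar_prod_self_real(1)[OF z_carrier]
    by (auto simp: u_def E_def J_def intro!: mult_nonneg_nonneg sum_nonneg)
  have u_0: "u 0 = b" by (simp add: u_def)
  have "s0 \<in> K"
    using \<open>a \<le> 1\<close> \<open>1 \<le> b\<close> u_nonneg u_0 by (auto simp: K_def s0_def)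
  have K_params: "s \<in> params" if "s \<in> K" for s
  proof -
    have *: "s i \<in> {(if i = 0 then a else 0)..u i}" for i using that unfolding K_def by blast
    have "s i \<ge> 0" if "i \<in> {1..r}" for i using *[of i] that by auto
    then show ?thesis using *[of 0] a by (auto simp: params_def)
  qed
  have "\<exists>s\<in>K. \<forall>t\<in>K. h s \<le> h t"
  proof (rule compact_attains_inf_pointwise_max[where D = D and g = g])
    show "compact K" unfolding K_def by (rule compact_box_fun)
    show "K \<noteq> {}" using \<open>s0 \<in> K\<close> by auto
    show "g v s \<le> h s" if "v \<in> D" "s \<in> K" for v s
      using g_le that K_params \<beta> by (auto simp: h_def)
    show "\<exists>v\<in>D. h s = g v s" if "s \<in> K" for s
      using \<beta>[OF K_params[OF that]] by (auto simp: h_def)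
    fix v assume "v \<in> D"
    then have v: "v \<in> carrier_vec n" by (simp add: D_def)
    have coord: "continuous_on K (\<lambda>s. s l)" for l
      by (rule continuous_on_subset[OF continuous_on_product_coordinates subset_UNIV])
    have "continuous_on K (\<lambda>s. ln (det (V s)))"
      using det_pos(1) K_params by (intro continuous_on_ln continuous_on_det continuous_on_V) (auto simp: less_imp_neq[THEN not_sym])
    moreover have "v \<bullet> (V s *\<^sub>v v) = s 0 * (v \<bullet> v) + (\<Sum>p\<in>J. s (fst p) * ((z p \<bullet> v) * (z p \<bullet> v)))" for s
      unfolding V_def using v by (subst gram_mat_bilinear) auto
    then have "continuous_on K (\<lambda>s. v \<bullet> (V s *\<^sub>v v))"
      by (auto intro!: continuous_intros coord)
    ultimately show "continuous_on K (g v)"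
      unfolding g_def by (intro continuous_on_diff continuous_on_add continuous_on_const)
  qed
  then obtain s where s: "s \<in> K" "\<And>t. t \<in> K \<Longrightarrow> h s \<le> h t" by blast
  have "h s \<le> objective c t" if c: "c \<in> carrier_vec m" and t: "t \<in> params" for c t
  \<comment> \<open>Points above level \<open>M\<close> lose to \<open>s0\<close>; the others are
    moved into \<open>K\<close> without changing the objective.\<close>
  proof (cases "objective c t \<le> M")
    case False
    then show ?thesis using s(2)[OF \<open>s0 \<in> K\<close>] by (simp add: M_def)
  next
    case True
    \<comment> \<open>A variance whose design matrix is zero does not affect \<open>V\<close> and may be reset to 0.\<close>
    define t' where "t' i = (if i = 0 \<or> (\<exists>j. (i, j) \<in> J \<and> z (i, j) \<noteq> 0\<^sub>v n) then t i else 0)" for i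
    have "t' i \<in> {(if i = 0 then a else 0)..u i}" for i
    proof (cases "i = 0")
      case True
      then show ?thesis using box[OF t c \<open>objective c t \<le> M\<close>] u_0 by (simp add: t'_def)
    next
      case False
      show ?thesis
      proof (cases "\<exists>j. (i, j) \<in> J \<and> z (i, j) \<noteq> 0\<^sub>v n")
        case True
        then obtain j where j: "(i, j) \<in> J" "z (i, j) \<noteq> 0\<^sub>v n" by blast
        then have "t i \<le> u i" "0 \<le> t i"
          using box[OF t c \<open>objective c t \<le> M\<close>] params_nonneg[OF t j(1)] by force+
        then show ?thesis using True False by (simp add: t'_def)
      qed (use False u_nonneg in \<open>auto simp: t'_def\<close>)
    qed
    then have t'K: "t' \<in> K" by (auto simp: K_def)
    have "V t' = V t"
    proof -
      have "t' (fst p) * (z p $ i * z p $ j) = t (fst p) * (z p $ i * z p $ j)" if "p \<in> J" "i < n" for p i j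
        using that by (cases "z p = 0\<^sub>v n") (auto simp: t'_def, metis prod.collapse)
      then show ?thesis
        unfolding V_def gram_mat_def by (intro eq_matI) (auto simp: t'_def intro!: sum.cong)
    qed
    then have "objective c t' = objective c t" by (rule objective_cong)
    then show ?thesis using s(2)[OF t'K] h_le[OF K_params[OF t'K] c] by simp
  qed
  then show ?thesis using K_params[OF s(1)] \<beta> unfolding h_def by blast
qed

text \<open>Vectors and functions yield the same objective values: a vector is read through its
  entries, and a function is truncated to its first \<open>r + 1\<close> values.\<close>

lemma mle_exists_iff:
  "mle_exists n m r X Z y \<longleftrightarrow>
    (\<exists>b\<in>carrier_vec m. \<exists>s\<in>params. \<forall>b'\<in>carrier_vec m. \<forall>s'\<in>params. objective b s \<le> objective b' s')"
    (is "_ \<longleftrightarrow> ?R")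
proof -
  have restrict: "\<exists>s'. s' \<in> carrier_vec (r + 1) \<and> (\<lambda>i. s' $ i) \<in> params \<and> (\<forall>b. objective b (\<lambda>i. s' $ i) = objective b s)"
    if "s \<in> params" for s
  proof (intro exI[of _ "vec (r + 1) s"] conjI allI)
    show "(\<lambda>i. vec (r + 1) s $ i) \<in> params" using that by (auto simp: params_def)
    show "objective b (\<lambda>i. vec (r + 1) s $ i) = objective b s" for b
      by (intro objective_cong V_cong) auto
  qed auto
  have "mle_exists n m r X Z y \<longleftrightarrow>
    (\<exists>b s. (b, s) \<in> param_space m r \<and> (\<forall>b' s'. (b', s') \<in> param_space m r \<longrightarrow>
      objective b (\<lambda>i. s $ i) \<le> objective b' (\<lambda>i. s' $ i)))"
    unfolding mle_exists_def mle_set_def neg2_loglik_eq by (simp add: set_eq_iff Ball_def)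
  also have "\<dots> \<longleftrightarrow> ?R"
  proof
    assume ?R
    then obtain b s where b: "b \<in> carrier_vec m" and s: "s \<in> params"
      and min: "\<forall>b'\<in>carrier_vec m. \<forall>s'\<in>params. objective b s \<le> objective b' s'" by blast
    obtain v where v: "v \<in> carrier_vec (r + 1)" "(\<lambda>i. v $ i) \<in> params" "\<And>b. objective b (\<lambda>i. v $ i) = objective b s"
      using restrict[OF s] by blast
    show "\<exists>b s. (b, s) \<in> param_space m r \<and> (\<forall>b' s'. (b', s') \<in> param_space m r \<longrightarrow>
        objective b (\<lambda>i. s $ i) \<le> objective b' (\<lambda>i. s' $ i))"
      using b v min by (intro exI[of _ b] exI[of _ v]) (simp add: param_space_eq)
  next
    assume "\<exists>b s. (b, s) \<in> param_space m r \<and> (\<forall>b' s'. (b', s') \<in> param_space m r \<longrightarrow>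
        objective b (\<lambda>i. s $ i) \<le> objective b' (\<lambda>i. s' $ i))"
    then obtain b v where b: "b \<in> carrier_vec m" and v: "(\<lambda>i. v $ i) \<in> params"
      and min: "\<And>b' v'. (b', v') \<in> param_space m r \<Longrightarrow> objective b (\<lambda>i. v $ i) \<le> objective b' (\<lambda>i. v' $ i)"
      by (auto simp: param_space_eq)
    have "objective b (\<lambda>i. v $ i) \<le> objective b' s'" if "b' \<in> carrier_vec m" "s' \<in> params" for b' s'
      using restrict[OF that(2)] min[of b'] that(1) unfolding param_space_eq by metis
    then show ?R using b v by blast
  qed
  finally show ?thesis .
qed

end

theorem proposition2p4:
  fixes n m r :: nat and k :: "nat \<Rightarrow> nat"
    and X :: "real mat" and Z :: "nat \<Rightarrow> real mat" and y :: "real vec"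
  assumes "X \<in> carrier_mat n m" and "m < n"
    and "\<And>i. i \<in> {1..r} \<Longrightarrow> Z i \<in> carrier_mat n (k i)"
    and "(\<Sum>i=1..r. k i) < n"
    and "y \<in> carrier_vec n"
  shows "mle_exists n m r X Z y \<longleftrightarrow> y \<notin> joint_col_space n X (block_row n r Z)"
proof -
  interpret variance_components n m r k X Z y
    using assms by unfold_locales
  show ?thesis
    unfolding mle_exists_iff joint_col_space_eq
  proof
    assume "\<exists>b\<in>carrier_vec m. \<exists>s\<in>params. \<forall>b'\<in>carrier_vec m. \<forall>s'\<in>params. objective b s \<le> objective b' s'"
    then obtain l where "\<forall>b\<in>carrier_vec m. \<forall>s\<in>params. l \<le> objective b s" by blast
    then show "y \<notin> vspan n (set (cols X) \<union> z ` J)"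
      using objective_unbounded_below[OF assms(4), of l] by (meson not_le)
  next
    assume "y \<notin> vspan n (set (cols X) \<union> z ` J)"
    then show "\<exists>b\<in>carrier_vec m. \<exists>s\<in>params. \<forall>b'\<in>carrier_vec m. \<forall>s'\<in>params. objective b s \<le> objective b' s'"
      using assms(2) by (intro objective_attains_inf) auto
  qed
qed

end
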